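(* For any integer $k\ge 3$, $\mathrm{ar}^*(n,O_{2k})=(1+o(1))\binom{n}{\lfloor n/2\rfloor}$ as $n\to\infty$.
   Context: $[n]=\{1,\dots,n\}$, $2^{[n]}$ its power set. A family $\mathcal{G}$ of sets is a strong copy of a poset $(P,\leqslant)$ if there is a bijection $f:P\to\mathcal{G}$ with $p\leqslant q\iff f(p)\subseteq f(q)$. $\mathrm{ar}^*(n,P)$ is the maximum number of colors used in a coloring of $2^{[n]}$ that admits no strong copy of $P$ whose sets all receive distinct colors. The crown poset $O_{2k}$ has elements $a_1,\dots,a_k,b_1,\dots,b_k$ whose only relations are $a_i<b_i$, $a_{i+1}<b_i$ for $i=1,\dots,k-1$, and $a_k<b_k$, $a_1<b_k$. *)

theory Defs
  imports "HOL-Library.Landau_Symbols"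
begin

text \<open>
  A poset is given by a carrier \<open>P\<close> and its (reflexive) order relation \<open>le\<close> as a set of pairs.
\<close>

definition strong_copy :: "'p set \<Rightarrow> 'p rel \<Rightarrow> 'a set set \<Rightarrow> bool" where
  "strong_copy P le G \<longleftrightarrow>
     (\<exists>f. bij_betw f P G \<and> (\<forall>p\<in>P. \<forall>q\<in>P. (p, q) \<in> le \<longleftrightarrow> f p \<subseteq> f q))"

definition rainbow :: "('a set \<Rightarrow> 'c) \<Rightarrow> 'a set set \<Rightarrow> bool" where
  "rainbow c G \<longleftrightarrow> inj_on c G"

text \<open>
  Only the values of \<open>c\<close> on \<open>Pow {1..n}\<close> matter. That set is finite, so taking
  natural numbers as colors loses no generality.
\<close>

definition rainbow_free_coloring :: "nat \<Rightarrow> 'p set \<Rightarrow> 'p rel \<Rightarrow> (nat set \<Rightarrow> nat) \<Rightarrow> bool" where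
  "rainbow_free_coloring n P le c \<longleftrightarrow>
     \<not> (\<exists>G. G \<subseteq> Pow {1..n} \<and> strong_copy P le G \<and> rainbow c G)"

text \<open>
  The maximum is over a finite set, which is nonempty as soon as \<open>P\<close> has at least two elements
  (see below); for smaller \<open>P\<close> no admissible coloring need exist and the value is irrelevant.
\<close>

definition ar_star :: "nat \<Rightarrow> 'p set \<Rightarrow> 'p rel \<Rightarrow> nat" where
  "ar_star n P le = Max {card (c ` Pow {1..n}) | c. rainbow_free_coloring n P le c}"

datatype crown_elem = A nat | B nat

definition crown_carrier :: "nat \<Rightarrow> crown_elem set" where
  "crown_carrier k = A ` {1..k} \<union> B ` {1..k}"

definition crown_order :: "nat \<Rightarrow> crown_elem rel" where
  "crown_order k =
     Id_on (crown_carrier k)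
     \<union> {(A i, B i) | i. 1 \<le> i \<and> i \<le> k - 1}
     \<union> {(A (i + 1), B i) | i. 1 \<le> i \<and> i \<le> k - 1}
     \<union> {(A k, B k), (A 1, B k)}"

lemma partial_order_on_crown:
  assumes "1 \<le> k"
  shows "partial_order_on (crown_carrier k) (crown_order k)"
  using assms
  unfolding partial_order_on_def preorder_on_def refl_on_def trans_def antisym_def
    crown_carrier_def crown_order_def
  by auto

lemma finite_color_counts:
  "finite {card (c ` Pow {1..n}) | c. rainbow_free_coloring n P le c}"
proof (rule finite_subset)
  show "{card (c ` Pow {1..n}) | c. rainbow_free_coloring n P le c} \<subseteq> {..card (Pow {1..n})}"
    by (auto intro!: card_image_le simp del: card_Pow)
qed simp

lemma rainbow_free_coloring_const:
  assumes "p \<in> P" "q \<in> P" "p \<noteq> q"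
  shows "rainbow_free_coloring n P le (\<lambda>_. 0)"
  unfolding rainbow_free_coloring_def strong_copy_def rainbow_def
proof clarify
  fix G f
  assume f: "bij_betw f P G" and inj: "inj_on (\<lambda>_. 0 :: nat) G"
  have "f p \<in> G" "f q \<in> G" using f assms by (auto simp: bij_betw_def)
  with inj have "f p = f q" by (auto simp: inj_on_def)
  with f assms show False by (auto simp: bij_betw_def inj_on_def)
qed

end

theory Submission
  imports Defs "HOL-Combinatorics.Permutations"
begin

text \<open>
  For the lower bound, give the sets of the middle level distinct colors and all other sets one
  further color: a rainbow crown has at most one set outside the middle level, but no crown with
  one element deleted is an antichain.

  For the upper bound, choose one representative of each color. Discard the few representatives
  outside levels \<open>n/2 \<plusminus> \<delta>n\<close> and those at most \<open>n\<close> representatives that share a color with one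
  of the sets \<open>X y = {1..n} - {y}\<close>. In the remaining family \<open>F\<close>, a fence
  \<open>f 0 \<subset> g 0 \<supset> f 1 \<subset> \<dots> \<subset> g (k-2) \<supset> f (k-1)\<close> with no further containments, in which exactly
  the two end sets miss \<open>y\<close>, is closed to a rainbow crown by \<open>X y\<close>. To find such a fence, take
  a random maximal chain. It meets \<open>F\<close> in at least \<open>1 + \<epsilon>\<close> sets on average, so the pairs of
  consecutive members have positive density. Averaging over \<open>y\<close> gives a \<open>y\<close> for which a positive
  proportion of these pairs contain \<open>y\<close> and have an upper set from which one can step down to a
  set of \<open>F\<close> missing \<open>y\<close>. After passing to a subgraph of large minimum degree a generic walk is
  the inner part of a fence: since \<open>\<delta>\<close> is small, a random step rarely adds or removes any
  prescribed point.
\<close>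

section \<open>Random maximal chains\<close>

text \<open>Composing with \<open>transpose u v\<close> exchanges the fibres of
  \<open>\<sigma> j\<close> over \<open>u\<close> and \<open>v\<close>, so all fibres over
  \<open>U\<close> have equal size: for random \<open>\<sigma>\<close> in \<open>S\<close>, the
  value \<open>\<sigma> j\<close> is uniform on \<open>U\<close>.\<close>

lemma card_fibre_transitive:
  assumes "finite S" "finite U"
    and val: "\<And>\<sigma>. \<sigma> \<in> S \<Longrightarrow> \<sigma> j \<in> U"
    and closed: "\<And>\<sigma> u v. \<lbrakk>\<sigma> \<in> S; u \<in> U; v \<in> U\<rbrakk> \<Longrightarrow> transpose u v \<circ> \<sigma> \<in> S"
    and "u \<in> U"
  shows "card {\<sigma>\<in>S. \<sigma> j = u} * card U = card S"
proof -
  have eq: "card {\<sigma>\<in>S. \<sigma> j = v} = card {\<sigma>\<in>S. \<sigma> j = u}" if "v \<in> U" for v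
  proof (rule bij_betw_same_card[of "\<lambda>\<sigma>. transpose u v \<circ> \<sigma>"],
      rule bij_betw_byWitness[where f' = "\<lambda>\<sigma>. transpose u v \<circ> \<sigma>"])
  qed (use that \<open>u \<in> U\<close> closed in \<open>auto simp: o_assoc[symmetric] fun_eq_iff\<close>)
  have "card S = card (\<Union>v\<in>U. {\<sigma>\<in>S. \<sigma> j = v})"
    by (rule arg_cong[of _ _ card]) (use val in auto)
  also have "\<dots> = (\<Sum>v\<in>U. card {\<sigma>\<in>S. \<sigma> j = v})"
    by (rule card_UN_disjoint) (use assms in auto)
  also have "\<dots> = (\<Sum>v\<in>U. card {\<sigma>\<in>S. \<sigma> j = u})"
    by (intro sum.cong refl eq)
  finally show ?thesis by simp
qed

text \<open>
  S permutation \<open>\<sigma>\<close> of \<open>{1..n}\<close> encodes the maximal chain of the sets \<open>\<sigma> ` {1..i}\<close>.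
\<close>

definition thru :: "nat \<Rightarrow> nat set \<Rightarrow> (nat \<Rightarrow> nat) set" where
  "thru n S = {\<sigma>. \<sigma> permutes {1..n} \<and> \<sigma> ` {1..card S} = S}"

lemma finite_thru [simp]: "finite (thru n S)"
  unfolding thru_def by (rule finite_subset[OF _ finite_permutations[of "{1..n}"]]) auto

lemma finite_if_thru: "\<sigma> \<in> thru n S \<Longrightarrow> finite S"
  unfolding thru_def by (metis (lifting) finite_atLeastAtMost finite_imageI mem_Collect_eq)

lemma thru_inj: "\<sigma> \<in> thru n S \<Longrightarrow> inj \<sigma>"
  by (auto simp: thru_def intro: permutes_inj)

lemma thru_mem_iff:
  assumes "\<sigma> \<in> thru n S" "1 \<le> j"
  shows "\<sigma> j \<in> S \<longleftrightarrow> j \<le> card S"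
proof -
  have "\<sigma> j \<in> \<sigma> ` {1..card S} \<longleftrightarrow> j \<in> {1..card S}"
    using thru_inj[OF assms(1)] by (simp add: inj_image_mem_iff)
  with assms show ?thesis by (auto simp: thru_def)
qed

lemma thru_le_n:
  assumes "\<sigma> \<in> thru n S" "1 \<le> j" "j \<le> n"
  shows "\<sigma> j \<in> {1..n}"
  using assms permutes_in_image[of \<sigma> "{1..n}" j] by (auto simp: thru_def)

lemma thru_obtain_index:
  assumes "\<sigma> \<in> thru n S" "x \<in> S"
  obtains j where "1 \<le> j" "j \<le> card S" "\<sigma> j = x"
  using assms by (force simp: thru_def)

lemma thru_chain:
  assumes "\<sigma> \<in> thru n S" "\<sigma> \<in> thru n T" "card S \<le> card T"
  shows "S \<subseteq> T"
proof -
  have "\<sigma> ` {1..card S} \<subseteq> \<sigma> ` {1..card T}" using assms(3) by (intro image_mono) auto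
  with assms show ?thesis by (auto simp: thru_def)
qed

lemma transpose_thru:
  assumes "\<sigma> \<in> thru n S" "u \<in> {1..n}" "v \<in> {1..n}" "u \<in> S \<longleftrightarrow> v \<in> S"
  shows "transpose u v \<circ> \<sigma> \<in> thru n S"
proof -
  have "(transpose u v \<circ> \<sigma>) permutes {1..n}"
    using assms by (intro permutes_compose permutes_swap_id) (auto simp: thru_def)
  moreover have "(transpose u v \<circ> \<sigma>) ` {1..card S} = transpose u v ` S"
    using assms(1) by (simp only: image_comp[symmetric]) (simp add: thru_def)
  moreover have "transpose u v ` S = S" using assms(4) by simp
  ultimately show ?thesis by (simp add: thru_def)
qed

text \<open>Transposing two points of \<open>S\<close> preserves the chains through
  \<open>S\<close>. Hence on a random chain through \<open>S\<close> each of the first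
  \<open>card S\<close> positions is uniform on \<open>S\<close>. The next lemma is the dual for
  later positions and the complement of \<open>S\<close>.\<close>

lemma card_thru_inside:
  assumes "S \<subseteq> {1..n}" "u \<in> S" "1 \<le> j" "j \<le> card S"
  shows "card {\<sigma>\<in>thru n S. \<sigma> j = u} * card S = card (thru n S)"
proof (rule card_fibre_transitive)
  show "transpose u v \<circ> \<sigma> \<in> thru n S" if "\<sigma> \<in> thru n S" "u \<in> S" "v \<in> S" for \<sigma> u v
    using that assms by (intro transpose_thru) auto
qed (use assms in \<open>auto simp: thru_mem_iff intro: finite_subset\<close>)

lemma card_thru_outside:
  assumes "S \<subseteq> {1..n}" "u \<in> {1..n} - S" "card S < j" "j \<le> n"
  shows "card {\<sigma>\<in>thru n S. \<sigma> j = u} * (n - card S) = card (thru n S)"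
proof -
  have "card {\<sigma>\<in>thru n S. \<sigma> j = u} * card ({1..n} - S) = card (thru n S)"
  proof (rule card_fibre_transitive)
    show "transpose u v \<circ> \<sigma> \<in> thru n S"
      if "\<sigma> \<in> thru n S" "u \<in> {1..n} - S" "v \<in> {1..n} - S" for \<sigma> u v
      using that assms by (intro transpose_thru) auto
    show "\<sigma> j \<in> {1..n} - S" if "\<sigma> \<in> thru n S" for \<sigma>
      using that assms thru_le_n[OF that, of j] thru_mem_iff[OF that, of j] by auto
  qed (use assms in auto)
  moreover have "card ({1..n} - S) = n - card S"
    using assms by (simp add: card_Diff_subset finite_subset)
  ultimately show ?thesis by simp
qed

text \<open>Once the last point of \<open>S\<close> is fixed as \<open>u\<close>, transpositions of
  other points of \<open>S\<close> keep this condition, so position \<open>j\<close> is uniform on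
  \<open>S - {u}\<close>.\<close>

lemma card_thru_inside2:
  assumes S: "S \<subseteq> {1..n}" and "u \<in> S" "v \<in> S" "u \<noteq> v" "1 \<le> j" "j < card S"
  shows "card {\<sigma>\<in>thru n S. \<sigma> (card S) = u \<and> \<sigma> j = v} * (card S * (card S - 1)) = card (thru n S)"
proof -
  have fin: "finite S" using S by (rule finite_subset) simp
  have "card {\<sigma>\<in>{\<sigma>\<in>thru n S. \<sigma> (card S) = u}. \<sigma> j = v} * card (S - {u})
      = card {\<sigma>\<in>thru n S. \<sigma> (card S) = u}"
  proof (rule card_fibre_transitive)
    show "\<sigma> j \<in> S - {u}" if "\<sigma> \<in> {\<sigma>\<in>thru n S. \<sigma> (card S) = u}" for \<sigma>
    proof -
      have "\<sigma> j \<noteq> \<sigma> (card S)" using that thru_inj[of \<sigma> n S] assms(6) by (auto dest: injD)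
      then show ?thesis using that assms by (auto simp: thru_mem_iff)
    qed
    show "transpose v w \<circ> \<sigma> \<in> {\<sigma>\<in>thru n S. \<sigma> (card S) = u}"
      if "\<sigma> \<in> {\<sigma>\<in>thru n S. \<sigma> (card S) = u}" "v \<in> S - {u}" "w \<in> S - {u}" for \<sigma> v w
    proof -
      have "transpose v w \<circ> \<sigma> \<in> thru n S" using that S by (intro transpose_thru) auto
      then show ?thesis using that by (simp add: transpose_def)
    qed
  qed (use assms fin in auto)
  moreover have "card {\<sigma>\<in>thru n S. \<sigma> (card S) = u} * card S = card (thru n S)"
    using assms by (intro card_thru_inside) auto
  ultimately show ?thesis
    using assms(2) fin by (simp add: conj_assoc mult.assoc mult_ac)
qed

text \<open>The chains through \<open>insert u S\<close> with last point \<open>u\<close> are the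
  chains through \<open>S\<close> with next point \<open>u\<close>. Counting them from both sides
  gives the ratio of consecutive values, which is inverse to that of the binomial
  coefficients.\<close>

lemma card_thru:
  assumes "S \<subseteq> {1..n}"
  shows "card (thru n S) * (n choose card S) = fact n"
proof -
  have "finite S" using assms by (rule finite_subset) simp
  then show ?thesis using assms
  proof (induction S rule: finite_induct)
    case empty
    have "thru n {} = {\<sigma>. \<sigma> permutes {1..n}}" by (auto simp: thru_def)
    then show ?case by (simp add: card_permutations)
  next
    case (insert u S)
    let ?i = "card S"
    have c: "card (insert u S) = Suc ?i" using insert by simp
    have lt: "?i < n" using insert.prems insert.hyps card_mono[of "{1..n}" "insert u S"] by auto
    have "{\<sigma>\<in>thru n (insert u S). \<sigma> (Suc ?i) = u} = {\<sigma>\<in>thru n S. \<sigma> (Suc ?i) = u}" (is "?L = ?R")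
    proof (intro set_eqI iffI)
      fix \<sigma> assume s: "\<sigma> \<in> ?L"
      then have p: "\<sigma> permutes {1..n}" and im: "\<sigma> ` {1..Suc ?i} = insert u S" and e: "\<sigma> (Suc ?i) = u"
        by (auto simp: thru_def c)
      have "\<sigma> ` ({1..Suc ?i} - {Suc ?i}) = insert u S - {u}"
        using im e permutes_inj[OF p] by (simp add: image_set_diff)
      moreover have "{1..Suc ?i} - {Suc ?i} = {1..?i}" by auto
      ultimately show "\<sigma> \<in> ?R" using p e insert.hyps by (simp add: thru_def)
    qed (auto simp: thru_def c atLeastAtMostSuc_conv)
    then have "card (thru n (insert u S)) = card ?R * Suc ?i"
      using card_thru_inside[OF insert.prems, of u "Suc ?i"] c by simp
    moreover have "card ?R * (n - ?i) = card (thru n S)"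
      using insert lt by (intro card_thru_outside) auto
    ultimately have rec: "card (thru n (insert u S)) * (n - ?i) = card (thru n S) * Suc ?i"
      by (simp only: mult_ac)
    have abs: "Suc ?i * (n choose Suc ?i) = (n - ?i) * (n choose ?i)"
      using binomial_absorb_comp[of n ?i] binomial_absorption[of ?i n] by simp
    have "Suc ?i * (card (thru n (insert u S)) * (n choose Suc ?i))
        = card (thru n (insert u S)) * (Suc ?i * (n choose Suc ?i))"
      by (simp only: mult_ac)
    also have "\<dots> = (card (thru n (insert u S)) * (n - ?i)) * (n choose ?i)"
      by (simp only: abs mult.assoc)
    also have "\<dots> = Suc ?i * (card (thru n S) * (n choose ?i))"
      by (simp only: rec) (simp only: mult_ac)
    also have "\<dots> = Suc ?i * fact n" using insert by simp
    finally show ?case unfolding c by (simp only: Suc_mult_cancel1)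
  qed
qed

lemma card_thru_pos:
  assumes "S \<subseteq> {1..n}"
  shows "card (thru n S) > 0"
  using card_thru[OF assms] by (intro gr0I) simp

section \<open>Random steps that avoid prescribed points\<close>

text \<open>A union bound over the chains through \<open>S\<close>. If no \<open>T\<close> is as
  required, a chain meeting some \<open>T\<close> with \<open>P T\<close> either has
  \<open>x\<close> outside \<open>T\<close>, at one of the positions \<open>m+1\<close> to
  \<open>card S\<close>, or has its last point \<open>\<sigma> (card S)\<close> in \<open>W\<close>.
  Each of these events has probability \<open>1 / card S\<close>.\<close>

lemma exists_lower_avoiding:
  fixes \<theta> :: real
  assumes S: "S \<subseteq> {1..n}"
    and good: "\<theta> * card (thru n S) \<le> card {\<sigma>\<in>thru n S. \<exists>T. P T \<and> \<sigma> \<in> thru n T}"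
    and P: "\<And>T. P T \<Longrightarrow> T \<subset> S \<and> m \<le> card T"
    and x: "x \<in> S" and W: "W \<subseteq> S"
    and small: "real (card S - m) + card W < \<theta> * card S"
  shows "\<exists>T. P T \<and> x \<in> T \<and> \<not> S - T \<subseteq> W"
proof (rule ccontr)
  assume neg: "\<not> ?thesis"
  have fin: "finite S" "finite W" using S W by (auto intro: finite_subset)
  let ?G = "{\<sigma>\<in>thru n S. \<exists>T. P T \<and> \<sigma> \<in> thru n T}"
  let ?X = "\<lambda>j x. {\<sigma>\<in>thru n S. \<sigma> j = x}"
  have "?G \<subseteq> (\<Union>j\<in>{m+1..card S}. ?X j x) \<union> (\<Union>v\<in>W. ?X (card S) v)"
  proof
    fix \<sigma> assume "\<sigma> \<in> ?G"
    then obtain T where \<sigma>: "\<sigma> \<in> thru n S" "\<sigma> \<in> thru n T" and T: "P T" by blast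
    have lt: "card T < card S" using P[OF T] fin by (simp add: psubset_card_mono)
    show "\<sigma> \<in> (\<Union>j\<in>{m+1..card S}. ?X j x) \<union> (\<Union>v\<in>W. ?X (card S) v)"
    proof (cases "x \<in> T")
      case True
      then have "S - T \<subseteq> W" using neg T by blast
      moreover have "\<sigma> (card S) \<in> S - T"
        using \<sigma> lt by (auto simp: thru_mem_iff)
      ultimately show ?thesis using \<sigma> by auto
    next
      case False
      obtain j where j: "1 \<le> j" "j \<le> card S" "\<sigma> j = x"
        using thru_obtain_index[OF \<sigma>(1) x] .
      moreover have "card T < j" using thru_mem_iff[OF \<sigma>(2) j(1)] j False by auto
      ultimately show ?thesis using \<sigma> P[OF T] by auto
    qed
  qed
  then have "card ?G \<le> card ((\<Union>j\<in>{m+1..card S}. ?X j x) \<union> (\<Union>v\<in>W. ?X (card S) v))"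
    using fin by (intro card_mono) auto
  also have "\<dots> \<le> card (\<Union>j\<in>{m+1..card S}. ?X j x) + card (\<Union>v\<in>W. ?X (card S) v)"
    by (rule card_Un_le)
  also have "\<dots> \<le> (\<Sum>j\<in>{m+1..card S}. card (?X j x)) + (\<Sum>v\<in>W. card (?X (card S) v))"
    using fin by (intro add_mono card_UN_le) auto
  finally have "card ?G * card S
      \<le> ((\<Sum>j\<in>{m+1..card S}. card (?X j x)) + (\<Sum>v\<in>W. card (?X (card S) v))) * card S"
    by (rule mult_right_mono) simp
  also have "\<dots> = (\<Sum>j\<in>{m+1..card S}. card (?X j x) * card S) + (\<Sum>v\<in>W. card (?X (card S) v) * card S)"
    by (simp add: distrib_right sum_distrib_right)
  also have "\<dots> = (\<Sum>j\<in>{m+1..card S}. card (thru n S)) + (\<Sum>v\<in>W. card (thru n S))"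
  proof -
    have "1 \<le> card S" using x fin by (metis One_nat_def Suc_leI card_gt_0_iff empty_iff)
    then show ?thesis
      using S x W by (intro arg_cong2[where f = "(+)"] sum.cong refl card_thru_inside) auto
  qed
  also have "\<dots> = ((card S - m) + card W) * card (thru n S)" by (simp add: distrib_right)
  finally have "real (card ?G * card S) \<le> real (((card S - m) + card W) * card (thru n S))"
    by (rule of_nat_mono)
  moreover have "\<theta> * card (thru n S) * card S \<le> real (card ?G) * card S"
    using good by (intro mult_right_mono) auto
  ultimately have "(\<theta> * card S) * card (thru n S) \<le> (real (card S - m) + card W) * card (thru n S)"
    by (simp add: mult_ac)
  then show False using small card_thru_pos[OF S] by simp
qed

text \<open>The dual union bound: a bad chain either adds a point of \<open>Z\<close> at a position
  from \<open>card S + 1\<close> to \<open>M\<close>, or its first new point lies in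
  \<open>W - S\<close>. As only the first new point counts for \<open>W\<close>, this set may be
  larger than the step by any fixed factor.\<close>

lemma exists_upper_avoiding:
  fixes \<theta> :: real
  assumes S: "S \<subseteq> {1..n}"
    and good: "\<theta> * card (thru n S) \<le> card {\<sigma>\<in>thru n S. \<exists>T. P T \<and> \<sigma> \<in> thru n T}"
    and P: "\<And>T. P T \<Longrightarrow> S \<subset> T \<and> card T \<le> M"
    and "M \<le> n" "card S < n"
    and Z: "Z \<subseteq> {1..n} - S" and W: "W \<subseteq> {1..n}"
    and small: "real (card Z * (M - card S)) + card (W - S) < \<theta> * (n - card S)"
  shows "\<exists>T. P T \<and> T \<inter> Z = {} \<and> \<not> T - S \<subseteq> W"
proof (rule ccontr)
  assume neg: "\<not> ?thesis"
  have fin: "finite Z" "finite W" using finite_subset[OF Z] finite_subset[OF W] by auto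
  let ?G = "{\<sigma>\<in>thru n S. \<exists>T. P T \<and> \<sigma> \<in> thru n T}"
  let ?X = "\<lambda>j x. {\<sigma>\<in>thru n S. \<sigma> j = x}"
  let ?U1 = "\<Union>z\<in>Z. \<Union>j\<in>{card S+1..M}. ?X j z" and ?U2 = "\<Union>v\<in>W - S. ?X (card S + 1) v"
  have "?G \<subseteq> ?U1 \<union> ?U2"
  proof
    fix \<sigma> assume "\<sigma> \<in> ?G"
    then obtain T where \<sigma>: "\<sigma> \<in> thru n S" "\<sigma> \<in> thru n T" and T: "P T" by blast
    have "finite T" using \<sigma>(2) by (rule finite_if_thru)
    then have lt: "card S < card T" using P[OF T] by (simp add: psubset_card_mono)
    show "\<sigma> \<in> ?U1 \<union> ?U2"
    proof (cases "T \<inter> Z = {}")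
      case True
      then have "T - S \<subseteq> W" using neg T by blast
      moreover have "\<sigma> (card S + 1) \<in> T - S"
        using \<sigma> lt by (auto simp: thru_mem_iff)
      ultimately show ?thesis using \<sigma> by auto
    next
      case False
      then obtain z where z: "z \<in> T" "z \<in> Z" by blast
      obtain j where j: "1 \<le> j" "j \<le> card T" "\<sigma> j = z"
        using thru_obtain_index[OF \<sigma>(2) z(1)] .
      moreover have "card S < j" using thru_mem_iff[OF \<sigma>(1) j(1)] j Z z by auto
      ultimately have "j \<in> {card S+1..M}" using P[OF T] by auto
      with \<sigma> z j show ?thesis by blast
    qed
  qed
  then have "card ?G \<le> card (?U1 \<union> ?U2)"
    using fin by (intro card_mono) auto
  also have "\<dots> \<le> card ?U1 + card ?U2"
    by (rule card_Un_le)
  also have "\<dots> \<le> (\<Sum>z\<in>Z. \<Sum>j\<in>{card S+1..M}. card (?X j z)) + (\<Sum>v\<in>W - S. card (?X (card S + 1) v))"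
    using fin by (intro add_mono card_UN_le order.trans[OF card_UN_le] sum_mono) auto
  finally have "card ?G * (n - card S) \<le> ((\<Sum>z\<in>Z. \<Sum>j\<in>{card S+1..M}. card (?X j z))
      + (\<Sum>v\<in>W - S. card (?X (card S + 1) v))) * (n - card S)"
    by (rule mult_right_mono) simp
  also have "\<dots> = (\<Sum>z\<in>Z. \<Sum>j\<in>{card S+1..M}. card (?X j z) * (n - card S))
      + (\<Sum>v\<in>W - S. card (?X (card S + 1) v) * (n - card S))"
    by (simp add: distrib_right sum_distrib_right)
  also have "\<dots> = (\<Sum>z\<in>Z. \<Sum>j\<in>{card S+1..M}. card (thru n S)) + (\<Sum>v\<in>W - S. card (thru n S))"
    using S Z W assms(4,5)
    by (intro arg_cong2[where f = "(+)"] sum.cong refl card_thru_outside) auto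
  also have "\<dots> = (card Z * (M - card S) + card (W - S)) * card (thru n S)" by (simp add: distrib_right)
  finally have "real (card ?G * (n - card S))
      \<le> real ((card Z * (M - card S) + card (W - S)) * card (thru n S))"
    by (rule of_nat_mono)
  moreover have "\<theta> * card (thru n S) * (n - card S) \<le> real (card ?G) * (n - card S)"
    using good by (intro mult_right_mono) auto
  ultimately have "(\<theta> * (n - card S)) * card (thru n S)
      \<le> (real (card Z * (M - card S)) + card (W - S)) * card (thru n S)"
    by (simp add: mult_ac)
  then have "\<theta> * (n - card S) \<le> real (card Z * (M - card S)) + card (W - S)"
    by (rule mult_right_le_imp_le) (use card_thru_pos[OF S] in simp)
  with small show False by (rule leD[THEN notE, rotated])
qed

text \<open>For \<open>y\<close> in \<open>S - Y\<close> fix \<open>x y\<close> such that every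
  admissible \<open>T\<close> missing \<open>y\<close> also misses \<open>x y\<close>. A chain with
  last point \<open>y\<close> that meets some \<open>T\<close> then has \<open>x y\<close> above
  \<open>T\<close> as well, hence at a position after \<open>m\<close>, which is rare. So most good
  chains have their last point in \<open>Y\<close>.\<close>

lemma card_separable_points:
  fixes \<eta> :: real
  assumes S: "S \<subseteq> {1..n}" and "2 \<le> card S"
    and good: "\<eta> * card (thru n S) \<le> card {\<sigma>\<in>thru n S. \<exists>T. P T \<and> \<sigma> \<in> thru n T}"
    and P: "\<And>T. P T \<Longrightarrow> T \<subset> S \<and> m \<le> card T"
  defines "Y \<equiv> {y\<in>S. \<forall>x\<in>S-{y}. \<exists>T. P T \<and> y \<notin> T \<and> x \<in> T}"
  shows "\<eta> * (card S * (card S - 1)) \<le> card Y * (card S - 1) + card S * (card S - m)"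
proof -
  have fin: "finite S" "finite Y" using S by (auto simp: Y_def intro: finite_subset)
  have "\<forall>y\<in>S-Y. \<exists>x. x \<in> S - {y} \<and> (\<forall>T. P T \<and> y \<notin> T \<longrightarrow> x \<notin> T)"
    by (auto simp: Y_def)
  then obtain x where x: "\<And>y. y \<in> S - Y \<Longrightarrow> x y \<in> S - {y} \<and> (\<forall>T. P T \<and> y \<notin> T \<longrightarrow> x y \<notin> T)"
    by metis
  let ?s = "card S"
  let ?G = "{\<sigma>\<in>thru n S. \<exists>T. P T \<and> \<sigma> \<in> thru n T}"
  let ?X = "\<lambda>y. {\<sigma>\<in>thru n S. \<sigma> ?s = y}"
  let ?X2 = "\<lambda>y j. {\<sigma>\<in>thru n S. \<sigma> ?s = y \<and> \<sigma> j = x y}"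
  let ?U1 = "\<Union>y\<in>Y. ?X y" and ?U2 = "\<Union>y\<in>S-Y. \<Union>j\<in>{m+1..<?s}. ?X2 y j"
  have "?G \<subseteq> ?U1 \<union> ?U2"
  proof
    fix \<sigma> assume "\<sigma> \<in> ?G"
    then obtain T where \<sigma>: "\<sigma> \<in> thru n S" "\<sigma> \<in> thru n T" and T: "P T" by blast
    have lt: "card T < ?s" using P[OF T] fin by (simp add: psubset_card_mono)
    let ?y = "\<sigma> ?s"
    have y: "?y \<in> S" "?y \<notin> T" using \<sigma> lt by (auto simp: thru_mem_iff)
    show "\<sigma> \<in> ?U1 \<union> ?U2"
    proof (cases "?y \<in> Y")
      case False
      then have xy: "x ?y \<in> S - {?y}" "x ?y \<notin> T" using x[of ?y] y T by auto
      then obtain j where j: "1 \<le> j" "j \<le> ?s" "\<sigma> j = x ?y"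
        using thru_obtain_index[OF \<sigma>(1), of "x ?y"] by blast
      moreover have "card T < j" using thru_mem_iff[OF \<sigma>(2) j(1)] j xy by auto
      moreover have "j \<noteq> ?s" using j xy by auto
      ultimately have "j \<in> {m+1..<?s}" using P[OF T] by auto
      then show ?thesis using False y \<sigma> j by blast
    qed (use \<sigma> in auto)
  qed
  then have "card ?G \<le> card (?U1 \<union> ?U2)"
    using fin by (intro card_mono) auto
  also have "\<dots> \<le> card ?U1 + card ?U2"
    by (rule card_Un_le)
  also have "\<dots> \<le> (\<Sum>y\<in>Y. card (?X y)) + (\<Sum>y\<in>S-Y. \<Sum>j\<in>{m+1..<?s}. card (?X2 y j))"
    using fin by (intro add_mono card_UN_le order.trans[OF card_UN_le] sum_mono) auto
  finally have "card ?G * (?s * (?s - 1)) \<le>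
      ((\<Sum>y\<in>Y. card (?X y)) + (\<Sum>y\<in>S-Y. \<Sum>j\<in>{m+1..<?s}. card (?X2 y j))) * (?s * (?s - 1))"
    by (rule mult_right_mono) simp
  also have "\<dots> = (\<Sum>y\<in>Y. card (?X y) * ?s) * (?s - 1)
      + (\<Sum>y\<in>S-Y. \<Sum>j\<in>{m+1..<?s}. card (?X2 y j) * (?s * (?s - 1)))"
    by (simp only: distrib_right sum_distrib_right mult.assoc)
  also have "\<dots> = (\<Sum>y\<in>Y. card (thru n S)) * (?s - 1)
      + (\<Sum>y\<in>S-Y. \<Sum>j\<in>{m+1..<?s}. card (thru n S))"
  proof -
    have "(\<Sum>y\<in>Y. card (?X y) * ?s) = (\<Sum>y\<in>Y. card (thru n S))"
      using S assms(2) by (intro sum.cong refl card_thru_inside) (auto simp: Y_def)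
    moreover have "card (?X2 y j) * (?s * (?s - 1)) = card (thru n S)"
      if "y \<in> S - Y" "j \<in> {m+1..<?s}" for y j
      using that x[OF that(1)] S by (intro card_thru_inside2) auto
    ultimately show ?thesis by simp
  qed
  also have "\<dots> \<le> (card Y * card (thru n S)) * (?s - 1) + ?s * ((?s - m) * card (thru n S))"
    using fin by (auto intro!: add_mono mult_mono card_mono)
  also have "\<dots> = (card Y * (?s - 1) + ?s * (?s - m)) * card (thru n S)"
    by (simp add: algebra_simps)
  finally have "real (card ?G * (?s * (?s - 1))) \<le> real ((card Y * (?s - 1) + ?s * (?s - m)) * card (thru n S))"
    by (rule of_nat_mono)
  moreover have "\<eta> * card (thru n S) * (?s * (?s - 1)) \<le> real (card ?G) * (?s * (?s - 1))"
    using good by (intro mult_right_mono) auto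
  ultimately have "(\<eta> * (?s * (?s - 1))) * card (thru n S)
      \<le> real (card Y * (?s - 1) + ?s * (?s - m)) * card (thru n S)"
    by (simp add: mult_ac)
  then show ?thesis by (rule mult_right_le_imp_le) (use card_thru_pos[OF S] in simp)
qed

section \<open>Subgraphs of large weighted minimum degree\<close>

text \<open>Vertices whose weighted degree is below their threshold are deleted one at a time. A
  deletion costs less weight than it frees in thresholds, so the strict inequality persists and the
  process stops at a nonempty graph.\<close>

lemma weighted_bipartite_core:
  fixes w :: "'a \<times> 'b \<Rightarrow> real"
  assumes "finite E" and "\<And>a. 0 \<le> p a" "\<And>b. 0 \<le> q b"
    and "sum p (fst ` E) + sum q (snd ` E) < sum w E"
  shows "\<exists>E'\<subseteq>E. E' \<noteq> {} \<and> (\<forall>(a,b)\<in>E'. p a \<le> sum w {e\<in>E'. fst e = a} \<and> q b \<le> sum w {e\<in>E'. snd e = b})"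
  using assms(1,4)
proof (induction E rule: finite_psubset_induct)
  case (psubset E)
  have step: ?case if "E'' \<subset> E" "sum p (fst ` E'') + sum q (snd ` E'') < sum w E''" for E''
    using psubset.IH[OF that] that(1) by blast
  consider "\<forall>(a,b)\<in>E. p a \<le> sum w {e\<in>E. fst e = a} \<and> q b \<le> sum w {e\<in>E. snd e = b}"
    | (a) a where "a \<in> fst ` E" "sum w {e\<in>E. fst e = a} < p a"
    | (b) b where "b \<in> snd ` E" "sum w {e\<in>E. snd e = b} < q b"
    by (fastforce simp: not_le)
  then show ?case
  proof cases
    case 1
    moreover have "E \<noteq> {}" using psubset.prems by auto
    ultimately show ?thesis by blast
  next
    case a
    let ?E = "{e\<in>E. fst e \<noteq> a}"
    have "sum w E = sum w {e\<in>E. fst e = a} + sum w ?E"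
      using psubset.hyps by (subst sum.union_disjoint[symmetric]) (auto intro: sum.cong)
    moreover have "sum p (fst ` E) = p a + sum p (fst ` ?E)"
    proof -
      have "fst ` ?E = fst ` E - {a}" by force
      then show ?thesis using a psubset.hyps by (simp add: sum.remove)
    qed
    moreover have "sum q (snd ` ?E) \<le> sum q (snd ` E)"
      using psubset.hyps assms(3) by (intro sum_mono2) auto
    ultimately show ?thesis using a psubset.prems by (intro step[of ?E]) auto
  next
    case b
    let ?E = "{e\<in>E. snd e \<noteq> b}"
    have "sum w E = sum w {e\<in>E. snd e = b} + sum w ?E"
      using psubset.hyps by (subst sum.union_disjoint[symmetric]) (auto intro: sum.cong)
    moreover have "sum q (snd ` E) = q b + sum q (snd ` ?E)"
    proof -
      have "snd ` ?E = snd ` E - {b}" by force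
      then show ?thesis using b psubset.hyps by (simp add: sum.remove)
    qed
    moreover have "sum p (fst ` ?E) \<le> sum p (fst ` E)"
      using psubset.hyps assms(2) by (intro sum_mono2) auto
    ultimately show ?thesis using b psubset.prems by (intro step[of ?E]) auto
  qed
qed

section \<open>Consecutive pairs in a dense family\<close>

text \<open>Consecutive members are used instead of all comparable pairs because a chain then gives
  each set at most one predecessor and one successor, so that weighted degrees count chains.\<close>

definition consec :: "nat \<Rightarrow> nat set set \<Rightarrow> (nat \<Rightarrow> nat) \<Rightarrow> nat set \<Rightarrow> nat set \<Rightarrow> bool" where
  "consec n F \<sigma> S T \<longleftrightarrow> S \<in> F \<and> T \<in> F \<and> \<sigma> \<in> thru n S \<and> \<sigma> \<in> thru n T \<and> S \<subset> T \<and>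
     \<not> (\<exists>R\<in>F. \<sigma> \<in> thru n R \<and> S \<subset> R \<and> R \<subset> T)"

definition consec_weight :: "nat \<Rightarrow> nat set set \<Rightarrow> nat set \<times> nat set \<Rightarrow> nat" where
  "consec_weight n F e = card {\<sigma>. consec n F \<sigma> (fst e) (snd e)}"

lemma finite_consec [simp]: "finite {\<sigma>. consec n F \<sigma> S T}"
  by (rule finite_subset[OF _ finite_thru[of n S]]) (auto simp: consec_def)

lemma thru_total:
  assumes "\<sigma> \<in> thru n S" "\<sigma> \<in> thru n T"
  shows "S \<subset> T \<or> S = T \<or> T \<subset> S"
  using thru_chain[OF assms] thru_chain[OF assms(2,1)] by (cases "card S \<le> card T") auto

lemma consec_unique_left:
  assumes "consec n F \<sigma> S T" "consec n F \<sigma> S' T"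
  shows "S = S'"
  using thru_total[of \<sigma> n S S'] assms unfolding consec_def by blast

lemma consec_unique_right:
  assumes "consec n F \<sigma> S T" "consec n F \<sigma> S T'"
  shows "T = T'"
  using thru_total[of \<sigma> n T T'] assms unfolding consec_def by blast

lemma in_weight:
  assumes "finite E"
  shows "(\<Sum>e\<in>{e\<in>E. snd e = T}. consec_weight n F e) = card {\<sigma>. \<exists>S. (S, T) \<in> E \<and> consec n F \<sigma> S T}"
proof -
  have "card {\<sigma>. \<exists>S. (S, T) \<in> E \<and> consec n F \<sigma> S T}
      = card (\<Union>e\<in>{e\<in>E. snd e = T}. {\<sigma>. consec n F \<sigma> (fst e) (snd e)})"
    by (rule arg_cong[of _ _ card]) force
  also have "\<dots> = (\<Sum>e\<in>{e\<in>E. snd e = T}. consec_weight n F e)"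
    unfolding consec_weight_def using assms
    by (intro card_UN_disjoint) (auto dest: consec_unique_left)
  finally show ?thesis ..
qed

lemma out_weight:
  assumes "finite E"
  shows "(\<Sum>e\<in>{e\<in>E. fst e = S}. consec_weight n F e) = card {\<sigma>. \<exists>T. (S, T) \<in> E \<and> consec n F \<sigma> S T}"
proof -
  have "card {\<sigma>. \<exists>T. (S, T) \<in> E \<and> consec n F \<sigma> S T}
      = card (\<Union>e\<in>{e\<in>E. fst e = S}. {\<sigma>. consec n F \<sigma> (fst e) (snd e)})"
    by (rule arg_cong[of _ _ card]) force
  also have "\<dots> = (\<Sum>e\<in>{e\<in>E. fst e = S}. consec_weight n F e)"
    unfolding consec_weight_def using assms
    by (intro card_UN_disjoint) (auto dest: consec_unique_right)
  finally show ?thesis ..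
qed

text \<open>Forgetting consecutiveness turns a degree bound into the hypothesis on chains that the
  avoidance lemmas take.\<close>

lemma in_weight_le:
  assumes "finite E"
  shows "(\<Sum>e\<in>{e\<in>E. snd e = T}. consec_weight n F e)
    \<le> card {\<sigma>\<in>thru n T. \<exists>S. (S, T) \<in> E \<and> \<sigma> \<in> thru n S}"
  unfolding in_weight[OF assms] by (rule card_mono) (auto simp: consec_def)

lemma out_weight_le:
  assumes "finite E"
  shows "(\<Sum>e\<in>{e\<in>E. fst e = S}. consec_weight n F e)
    \<le> card {\<sigma>\<in>thru n S. \<exists>T. (S, T) \<in> E \<and> \<sigma> \<in> thru n T}"
  unfolding out_weight[OF assms] by (rule card_mono) (auto simp: consec_def)

text \<open>Among the members of \<open>F\<close> on a chain, only the lowest has no predecessor in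
  \<open>F\<close>.\<close>

lemma card_chain_le:
  assumes "finite F"
  shows "card {T\<in>F. \<sigma> \<in> thru n T} \<le> card {T\<in>F. \<exists>S. consec n F \<sigma> S T} + 1"
proof -
  let ?H = "{T\<in>F. \<sigma> \<in> thru n T}" and ?K = "{T\<in>F. \<exists>S. consec n F \<sigma> S T}"
  have pred: "T \<in> ?K" if T: "T \<in> ?H" and S: "S \<in> ?H" "S \<subset> T" for S T
  proof -
    have "finite {R\<in>?H. R \<subset> T}" "{R\<in>?H. R \<subset> T} \<noteq> {}" using assms S by auto
    from finite_has_maximal[OF this] obtain R
      where "R \<in> ?H" "R \<subset> T" "\<And>R'. \<lbrakk>R' \<in> ?H; R' \<subset> T; R \<subseteq> R'\<rbrakk> \<Longrightarrow> R = R'"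
      by auto
    then have "consec n F \<sigma> R T" using T unfolding consec_def by blast
    then show ?thesis using T by blast
  qed
  have "finite (?H - ?K)" using assms by simp
  then have "card (?H - ?K) \<le> Suc 0"
    using pred thru_total by (subst card_le_Suc0_iff_eq) blast+
  moreover have "card ?H \<le> card ?K + card (?H - ?K)"
    by (rule order.trans[OF card_mono card_Un_le]) (use assms in auto)
  ultimately show ?thesis by linarith
qed

text \<open>The bound for a single chain is summed over all permutations, and both sides are counted
  again by sets. Thus every excess over one member of \<open>F\<close> per chain is paid for by
  consecutive pairs.\<close>

lemma sum_thru_le_consec_weight:
  assumes "finite F"
  shows "(\<Sum>S\<in>F. card (thru n S)) \<le> (\<Sum>e\<in>F \<times> F. consec_weight n F e) + fact n"
proof -
  let ?P = "{\<sigma>. \<sigma> permutes {1..n}}"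
  have finP: "finite ?P" by (rule finite_permutations) simp
  have 1: "(\<Sum>\<sigma>\<in>?P. card {T\<in>F. \<sigma> \<in> thru n T}) = (\<Sum>T\<in>F. card (thru n T))"
  proof (rule sum_multicount_gen[OF finP assms], rule ballI)
    show "card {\<sigma>\<in>?P. \<sigma> \<in> thru n T} = card (thru n T)" for T
      by (rule arg_cong[of _ _ card]) (auto simp: thru_def)
  qed
  have 2: "(\<Sum>\<sigma>\<in>?P. card {T\<in>F. \<exists>S. consec n F \<sigma> S T}) = (\<Sum>T\<in>F. \<Sum>S\<in>F. consec_weight n F (S, T))"
  proof (rule sum_multicount_gen[OF finP assms], rule ballI)
    fix T assume T: "T \<in> F"
    have "(\<Sum>S\<in>F. consec_weight n F (S, T)) = (\<Sum>e\<in>{e\<in>F \<times> F. snd e = T}. consec_weight n F e)"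
      by (rule sum.reindex_bij_witness[where i = fst and j = "\<lambda>S. (S, T)"]) (use T in auto)
    also have "\<dots> = card {\<sigma>. \<exists>S. (S, T) \<in> F \<times> F \<and> consec n F \<sigma> S T}"
      using assms by (intro in_weight) simp
    also have "\<dots> = card {\<sigma>\<in>?P. \<exists>S. consec n F \<sigma> S T}"
      by (rule arg_cong[of _ _ card]) (auto simp: consec_def thru_def)
    finally show "card {\<sigma>\<in>?P. \<exists>S. consec n F \<sigma> S T} = (\<Sum>S\<in>F. consec_weight n F (S, T))" ..
  qed
  have "(\<Sum>\<sigma>\<in>?P. card {T\<in>F. \<sigma> \<in> thru n T}) \<le> (\<Sum>\<sigma>\<in>?P. card {T\<in>F. \<exists>S. consec n F \<sigma> S T} + 1)"
    by (intro sum_mono card_chain_le assms)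
  also have "\<dots> = (\<Sum>T\<in>F. \<Sum>S\<in>F. consec_weight n F (S, T)) + fact n"
    unfolding sum.distrib 2 by (simp add: card_permutations)
  also have "(\<Sum>T\<in>F. \<Sum>S\<in>F. consec_weight n F (S, T)) = (\<Sum>e\<in>F \<times> F. consec_weight n F e)"
    by (subst sum.swap) (simp add: sum.cartesian_product)
  finally show ?thesis unfolding 1 .
qed

text \<open>
  Separating \<open>y\<close> from every other point is what later allows the last step of a fence, whose
  only prescribed feature is the missing \<open>y\<close>, to keep a witness of incomparability.
\<close>

definition separable :: "nat set set \<Rightarrow> nat set \<Rightarrow> nat set" where
  "separable F T = {y\<in>T. \<forall>x\<in>T-{y}. \<exists>S\<in>F. S \<subset> T \<and> y \<notin> S \<and> x \<in> S}"

text \<open>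
  Consecutive pairs carry a positive proportion of the chain incidences of a dense family.
  Averaging over \<open>y\<close> and discarding vertices of small degree leaves pairs among which one can
  walk up and down in many ways while keeping \<open>y\<close>, and leave \<open>y\<close> at any upper set.
\<close>

lemma exists_core:
  fixes \<epsilon> \<theta> :: real
  assumes F: "F \<subseteq> Pow {1..n}" and lev: "\<And>S. S \<in> F \<Longrightarrow> m \<le> card S \<and> card S \<le> M"
    and \<epsilon>: "0 < \<epsilon>" "\<epsilon> \<le> 1"
    and big: "(1 + \<epsilon>) * fact n \<le> (\<Sum>S\<in>F. real (card (thru n S)))"
    and m: "2 \<le> m" "n \<le> 4 * m" "16 * real (M - m) \<le> \<epsilon> * (real m - 1)"
  defines "\<theta> \<equiv> \<epsilon>\<^sup>2 / 512"
  obtains y E where "y \<in> {1..n}" "E \<noteq> {}" "E \<subseteq> F \<times> F"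
    "\<And>S T. (S, T) \<in> E \<Longrightarrow> S \<subset> T \<and> y \<in> S \<and> y \<in> separable F T"
    "\<And>S T. (S, T) \<in> E \<Longrightarrow> \<theta> * card (thru n S) \<le> card {\<sigma>\<in>thru n S. \<exists>T. (S, T) \<in> E \<and> \<sigma> \<in> thru n T}"
    "\<And>S T. (S, T) \<in> E \<Longrightarrow> \<theta> * card (thru n T) \<le> card {\<sigma>\<in>thru n T. \<exists>S. (S, T) \<in> E \<and> \<sigma> \<in> thru n S}"
proof -
  have finF: "finite F" using F by (rule finite_subset) simp
  define w where "w e = real (consec_weight n F e)" for e
  define t where "t S = real (card (thru n S))" for S
  define N where "N = (\<Sum>S\<in>F. t S)"
  define \<eta> where "\<eta> = \<epsilon> / 4"
  define D where "D T = (\<Sum>S\<in>F. w (S, T))" for T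
  \<comment> \<open>Only an upper set that is reached from below on a proportion
    \<open>\<eta>\<close> of its chains is known to have many separable points. The other upper sets
    carry weight at most \<open>\<eta> * N\<close>.\<close>
  define G where "G = {T\<in>F. \<eta> * t T \<le> D T}"
  have w0: "w e \<ge> 0" for e by (simp add: w_def)
  have t0: "t S \<ge> 0" for S by (simp add: t_def)
  have "N > 0" using big \<epsilon> unfolding N_def t_def
    by (smt (verit) fact_gt_zero mult_pos_pos)
  have "real (\<Sum>S\<in>F. card (thru n S)) \<le> real ((\<Sum>e\<in>F \<times> F. consec_weight n F e) + fact n)"
    by (intro of_nat_mono sum_thru_le_consec_weight finF)
  then have "N \<le> (\<Sum>e\<in>F \<times> F. w e) + fact n" by (simp add: N_def t_def w_def)
  \<comment> \<open>By \<open>big\<close>, \<open>(1 + \<epsilon>) * fact n\<close> is at most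
    \<open>N\<close>. Hence \<open>\<epsilon> * N\<close> is at most twice the total weight, which
    is the reason for \<open>\<eta> = \<epsilon> / 4\<close>.\<close>
  then have "(1 + \<epsilon>) * N \<le> (1 + \<epsilon>) * (\<Sum>e\<in>F \<times> F. w e) + N"
    using big \<epsilon> mult_left_mono[of N "(\<Sum>e\<in>F \<times> F. w e) + fact n" "1 + \<epsilon>"]
    unfolding N_def t_def by (simp add: distrib_left)
  moreover have "(1 + \<epsilon>) * (\<Sum>e\<in>F \<times> F. w e) \<le> 2 * (\<Sum>e\<in>F \<times> F. w e)"
    using \<epsilon> by (intro mult_right_mono sum_nonneg w0) auto
  ultimately have tot: "2 * \<eta> * N \<le> (\<Sum>e\<in>F \<times> F. w e)"
    unfolding \<eta>_def by (simp add: algebra_simps)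
  have "(\<Sum>e\<in>F \<times> F. w e) = (\<Sum>T\<in>F. D T)"
    unfolding D_def by (subst sum.swap) (simp add: sum.cartesian_product)
  also have "\<dots> = (\<Sum>T\<in>F-G. D T) + (\<Sum>T\<in>G. D T)"
    using finF by (intro sum.subset_diff) (auto simp: G_def)
  also have "(\<Sum>T\<in>F-G. D T) \<le> (\<Sum>T\<in>F-G. \<eta> * t T)"
    by (intro sum_mono) (auto simp: G_def)
  also have "\<dots> \<le> (\<Sum>T\<in>F. \<eta> * t T)"
    using finF \<epsilon> by (intro sum_mono2) (auto simp: \<eta>_def t0)
  also have "\<dots> = \<eta> * N" by (simp add: N_def sum_distrib_left)
  finally have "\<eta> * N \<le> (\<Sum>T\<in>G. D T)" using tot by linarith
  define E1 where "E1 = {e\<in>F \<times> G. fst e \<subset> snd e}"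
  have GF: "G \<subseteq> F" by (auto simp: G_def)
  then have finG: "finite G" using finF finite_subset by blast
  have finE1: "finite E1" unfolding E1_def using finF finG by simp
  have wE1: "\<eta> * N \<le> (\<Sum>e\<in>E1. w e)"
  proof -
    have "(\<Sum>T\<in>G. D T) = (\<Sum>e\<in>F \<times> G. w e)"
      unfolding D_def by (subst sum.swap) (simp add: sum.cartesian_product)
    also have "\<dots> = (\<Sum>e\<in>E1. w e)"
      by (rule sum.mono_neutral_right)
        (use finF finG in \<open>auto simp: E1_def w_def consec_weight_def consec_def\<close>)
    finally show ?thesis using \<open>\<eta> * N \<le> (\<Sum>T\<in>G. D T)\<close> by simp
  qed
  \<comment> \<open>\<open>T\<close> has at least \<open>3 / 4 * \<eta> * m\<close> separable
    points, and at most \<open>M - m\<close>, hence at most \<open>\<eta> / 4 * m\<close>, of them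
    lie outside \<open>S\<close>.\<close>
  have many: "\<eta> / 2 * m \<le> card (separable F T \<inter> S)" if e: "(S, T) \<in> E1" for S T
  proof -
    have T: "T \<in> G" "T \<in> F" "T \<subseteq> {1..n}" and S: "S \<in> F" "S \<subset> T"
      using e GF F by (auto simp: E1_def)
    have fT: "finite T" using T finite_subset by blast
    have cT: "m \<le> card T" "card T \<le> M" and cS: "m \<le> card S" using lev T S by auto
    let ?s = "card T" and ?y = "card (separable F T)"
    have "D T = real (\<Sum>e\<in>{e\<in>F \<times> F. snd e = T}. consec_weight n F e)"
      unfolding D_def w_def of_nat_sum[symmetric] of_nat_eq_iff
      by (rule sum.reindex_bij_witness[where i = fst and j = "\<lambda>S. (S, T)"]) (use T in auto)
    also have "\<dots> = card {\<sigma>. \<exists>S. (S, T) \<in> F \<times> F \<and> consec n F \<sigma> S T}"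
      using finF by (subst in_weight) auto
    also have "\<dots> \<le> card {\<sigma>\<in>thru n T. \<exists>S. (S \<in> F \<and> S \<subset> T) \<and> \<sigma> \<in> thru n S}"
      by (intro of_nat_mono card_mono) (auto simp: consec_def)
    finally have "\<eta> * card (thru n T) \<le> card {\<sigma>\<in>thru n T. \<exists>S. (S \<in> F \<and> S \<subset> T) \<and> \<sigma> \<in> thru n S}"
      using T(1) by (simp add: G_def t_def)
    then have "\<eta> * (?s * (?s - 1)) \<le>
        card {y\<in>T. \<forall>x\<in>T-{y}. \<exists>S. (S \<in> F \<and> S \<subset> T) \<and> y \<notin> S \<and> x \<in> S} * (?s - 1) + ?s * (?s - m)"
      using m(1) cT lev T(3) by (intro card_separable_points) auto
    also have "{y\<in>T. \<forall>x\<in>T-{y}. \<exists>S. (S \<in> F \<and> S \<subset> T) \<and> y \<notin> S \<and> x \<in> S} = separable F T"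
      by (auto simp: separable_def)
    finally have "\<eta> * (real ?s * real (?s - 1)) \<le> ?y * real (?s - 1) + real ?s * (?s - m)" by simp
    moreover have "real ?s * real (?s - m) \<le> real ?s * (\<eta> / 4 * real (?s - 1))"
    proof (intro mult_left_mono)
      have "real (?s - m) \<le> real (M - m)" using cT by simp
      also have "\<dots> \<le> \<eta> / 4 * (real m - 1)" using m(3) by (simp add: \<eta>_def)
      also have "\<dots> \<le> \<eta> / 4 * real (?s - 1)" using cT \<epsilon> by (intro mult_left_mono) (auto simp: \<eta>_def)
      finally show "real (?s - m) \<le> \<eta> / 4 * real (?s - 1)" .
    qed simp
    ultimately have "(3 / 4 * \<eta> * ?s) * real (?s - 1) \<le> ?y * real (?s - 1)"
      by (simp add: algebra_simps)
    then have "3 / 4 * \<eta> * ?s \<le> ?y"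
      by (rule mult_right_le_imp_le) (use m(1) cT in simp)
    moreover have "3 / 4 * \<eta> * m \<le> 3 / 4 * \<eta> * ?s" using cT \<epsilon> by (intro mult_left_mono) (auto simp: \<eta>_def)
    moreover have "?y \<le> card (separable F T \<inter> S) + (M - m)"
    proof -
      have "separable F T \<subseteq> (separable F T \<inter> S) \<union> (T - S)" by (auto simp: separable_def)
      then have "?y \<le> card ((separable F T \<inter> S) \<union> (T - S))"
        using fT S by (intro card_mono) (auto intro: finite_subset)
      also have "\<dots> \<le> card (separable F T \<inter> S) + card (T - S)" by (rule card_Un_le)
      also have "card (T - S) = card T - card S"
        using fT S by (intro card_Diff_subset) (auto intro: finite_subset)
      finally show ?thesis using cT cS by linarith
    qed
    moreover have "real (M - m) \<le> \<eta> / 4 * m"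
    proof -
      have "real (M - m) \<le> \<eta> / 4 * (real m - 1)" using m(3) by (simp add: \<eta>_def)
      also have "\<dots> \<le> \<eta> / 4 * m" using \<epsilon> by (intro mult_left_mono) (auto simp: \<eta>_def)
      finally show ?thesis .
    qed
    ultimately show ?thesis by (simp add: of_nat_diff)
  qed
  define Ey where "Ey y = {e\<in>E1. y \<in> separable F (snd e) \<inter> fst e}" for y
  have sw: "(\<Sum>y\<in>{1..n}. \<Sum>e\<in>Ey y. w e) = (\<Sum>e\<in>E1. w e * card (separable F (snd e) \<inter> fst e))"
  proof -
    have "(\<Sum>y\<in>{1..n}. \<Sum>e\<in>Ey y. w e)
        = (\<Sum>e\<in>E1. \<Sum>y\<in>{y\<in>{1..n}. y \<in> separable F (snd e) \<inter> fst e}. w e)"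
      unfolding Ey_def using finE1 by (intro sum.swap_restrict) auto
    also have "\<dots> = (\<Sum>e\<in>E1. w e * card (separable F (snd e) \<inter> fst e))"
    proof (intro sum.cong refl)
      fix e assume "e \<in> E1"
      then have "fst e \<subseteq> {1..n}" using F by (cases e) (auto simp only: E1_def mem_Collect_eq mem_Times_iff)
      then have "{y\<in>{1..n}. y \<in> separable F (snd e) \<inter> fst e} = separable F (snd e) \<inter> fst e"
        by blast
      then show "(\<Sum>y\<in>{y\<in>{1..n}. y \<in> separable F (snd e) \<inter> fst e}. w e)
          = w e * card (separable F (snd e) \<inter> fst e)" by simp
    qed
    finally show ?thesis .
  qed
  have "\<eta> / 2 * m * (\<eta> * N) \<le> \<eta> / 2 * m * (\<Sum>e\<in>E1. w e)"
    using \<epsilon> wE1 by (intro mult_left_mono) (auto simp: \<eta>_def)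
  also have "\<dots> = (\<Sum>e\<in>E1. w e * (\<eta> / 2 * m))"
    unfolding sum_distrib_left by (intro sum.cong refl mult.commute)
  also have "\<dots> \<le> (\<Sum>e\<in>E1. w e * card (separable F (snd e) \<inter> fst e))"
    by (intro sum_mono mult_left_mono many w0) auto
  finally have avg: "\<eta> / 2 * m * (\<eta> * N) \<le> (\<Sum>y\<in>{1..n}. \<Sum>e\<in>Ey y. w e)" unfolding sw .
  have n1: "1 \<le> n"
  proof (rule ccontr)
    assume "\<not> 1 \<le> n"
    then have "F \<subseteq> {{}}" using F by auto
    then have "F = {}" using lev m(1) by fastforce
    then show False using \<open>N > 0\<close> by (simp add: N_def)
  qed
  \<comment> \<open>Every pair in \<open>E1\<close> lies in at least \<open>\<eta> / 2 * m\<close>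
    of the graphs \<open>Ey y\<close>. Averaging over the \<open>n \<le> 4 * m\<close> choices of
    \<open>y\<close> turns the weight \<open>\<eta> * N\<close> into the stated bound.\<close>
  have "\<exists>y\<in>{1..n}. \<eta>\<^sup>2 / 8 * N \<le> (\<Sum>e\<in>Ey y. w e)"
  proof (rule ccontr)
    assume "\<not> ?thesis"
    then have "(\<Sum>e\<in>Ey y. w e) < \<eta>\<^sup>2 / 8 * N" if "y \<in> {1..n}" for y
      using that by (meson not_le)
    then have "(\<Sum>y\<in>{1..n}. \<Sum>e\<in>Ey y. w e) < (\<Sum>y\<in>{1..n}. \<eta>\<^sup>2 / 8 * N)"
      using n1 by (intro sum_strict_mono) (simp_all only: finite_atLeastAtMost atLeastatMost_empty_iff not_less not_le not_True_eq_False not_False_eq_True)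
    also have "\<dots> = n * (\<eta>\<^sup>2 / 8 * N)" by simp
    also have "\<dots> \<le> real (4 * m) * (\<eta>\<^sup>2 / 8 * N)"
      using m(2) \<open>N > 0\<close> by (intro mult_right_mono) auto
    also have "\<dots> = \<eta> / 2 * m * (\<eta> * N)" by (simp add: power2_eq_square)
    finally show False using avg by simp
  qed
  then obtain y where y: "y \<in> {1..n}" and wy: "\<eta>\<^sup>2 / 8 * N \<le> (\<Sum>e\<in>Ey y. w e)" by blast
  have finEy: "finite (Ey y)" unfolding Ey_def using finE1 by simp
  have EyF: "Ey y \<subseteq> F \<times> F" unfolding Ey_def E1_def using GF by auto
  \<comment> \<open>With this \<open>\<theta>\<close> the thresholds on both sides sum to at most
    \<open>2 * \<theta> * N\<close>, half of the weight of \<open>Ey y\<close>, as the deletion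
    argument requires.\<close>
  have \<theta>: "\<theta> = \<eta>\<^sup>2 / 32" by (simp add: \<theta>_def \<eta>_def power2_eq_square)
  have \<theta>0: "\<theta> > 0" using \<epsilon> by (simp add: \<theta>_def)
  have bd: "(\<Sum>S\<in>X. \<theta> * t S) \<le> \<theta> * N" if "X \<subseteq> F" for X
    unfolding N_def sum_distrib_left using that finF \<theta>0 by (intro sum_mono2) (auto simp: t0)
  have "(\<Sum>S\<in>fst ` Ey y. \<theta> * t S) + (\<Sum>S\<in>snd ` Ey y. \<theta> * t S) \<le> \<theta> * N + \<theta> * N"
    using EyF by (intro add_mono bd) auto
  also have "\<dots> < \<eta>\<^sup>2 / 8 * N" using \<open>N > 0\<close> \<epsilon> by (simp add: \<theta> \<eta>_def)
  also have "\<dots> \<le> sum w (Ey y)" by (rule wy)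
  finally have "\<exists>E'\<subseteq>Ey y. E' \<noteq> {} \<and> (\<forall>(S,T)\<in>E'. \<theta> * t S \<le> sum w {e\<in>E'. fst e = S} \<and>
      \<theta> * t T \<le> sum w {e\<in>E'. snd e = T})"
    using finEy \<theta>0 t0 by (intro weighted_bipartite_core) auto
  then obtain E where E: "E \<subseteq> Ey y" "E \<noteq> {}"
    and core: "\<forall>(S,T)\<in>E. \<theta> * t S \<le> sum w {e\<in>E. fst e = S} \<and> \<theta> * t T \<le> sum w {e\<in>E. snd e = T}"
    by (elim exE conjE)
  have dS: "\<theta> * t S \<le> sum w {e\<in>E. fst e = S}" and dT: "\<theta> * t T \<le> sum w {e\<in>E. snd e = T}"
    if "(S, T) \<in> E" for S T
    using bspec[OF core that] by simp_all
  have finE: "finite E" using E(1) finEy by (rule finite_subset)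
  show thesis
  proof (rule that[OF y E(2)])
    show "E \<subseteq> F \<times> F" using E EyF by blast
    show "S \<subset> T \<and> y \<in> S \<and> y \<in> separable F T" if "(S, T) \<in> E" for S T
      using subsetD[OF E(1) that] by (simp add: Ey_def E1_def)
    show "\<theta> * card (thru n S) \<le> card {\<sigma>\<in>thru n S. \<exists>T. (S, T) \<in> E \<and> \<sigma> \<in> thru n T}"
      if "(S, T) \<in> E" for S T
    proof -
      have "sum w {e\<in>E. fst e = S} \<le> card {\<sigma>\<in>thru n S. \<exists>T. (S, T) \<in> E \<and> \<sigma> \<in> thru n T}"
        unfolding w_def of_nat_sum[symmetric] by (intro of_nat_mono out_weight_le finE)
      then show ?thesis using dS[OF that] by (simp add: t_def)
    qed
    show "\<theta> * card (thru n T) \<le> card {\<sigma>\<in>thru n T. \<exists>S. (S, T) \<in> E \<and> \<sigma> \<in> thru n S}"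
      if "(S, T) \<in> E" for S T
    proof -
      have "sum w {e\<in>E. snd e = T} \<le> card {\<sigma>\<in>thru n T. \<exists>S. (S, T) \<in> E \<and> \<sigma> \<in> thru n S}"
        unfolding w_def of_nat_sum[symmetric] by (intro of_nat_mono in_weight_le finE)
      then show ?thesis using dT[OF that] by (simp add: t_def)
    qed
  qed
qed

section \<open>Fences and crowns\<close>

text \<open>The fence grows from left to right: \<open>down\<close> leads from \<open>g j\<close> to
  \<open>f (Suc j)\<close>, \<open>up\<close> leads on to \<open>g (Suc j)\<close>, and
  \<open>leave\<close> supplies the two ends. Each step keeps or avoids the few points that witness
  non-containment; \<open>down\<close> and \<open>up\<close> have the form that the union bounds on
  random chains deliver.\<close>

lemma exists_fence:
  fixes E :: "('a set \<times> 'a set) set"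
  assumes k: "3 \<le> k" and "E \<noteq> {}" and EF: "E \<subseteq> F \<times> F" and "finite U"
    and edge: "\<And>S T. (S, T) \<in> E \<Longrightarrow> S \<subseteq> T \<and> T \<subseteq> U \<and> y \<in> S"
    and diff: "\<And>S T. \<lbrakk>S \<in> F; T \<in> F; S \<subseteq> T\<rbrakk> \<Longrightarrow> card (T - S) \<le> d"
    and leave: "\<And>S T x. \<lbrakk>(S, T) \<in> E; x \<in> T; x \<noteq> y\<rbrakk> \<Longrightarrow> \<exists>R\<in>F. R \<subseteq> T \<and> y \<notin> R \<and> x \<in> R"
    and nontriv: "\<And>S T. (S, T) \<in> E \<Longrightarrow> \<exists>x\<in>T. x \<noteq> y"
    and down: "\<And>S T x W. \<lbrakk>(S, T) \<in> E; x \<in> T; W \<subseteq> T; card W \<le> d\<rbrakk>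
      \<Longrightarrow> \<exists>S'. (S', T) \<in> E \<and> x \<in> S' \<and> \<not> T - S' \<subseteq> W"
    and up: "\<And>S T Z W. \<lbrakk>(S, T) \<in> E; Z \<subseteq> U - S; W \<subseteq> U; card Z \<le> k; card (W - S) \<le> k * d\<rbrakk>
      \<Longrightarrow> \<exists>T'. (S, T') \<in> E \<and> T' \<inter> Z = {} \<and> \<not> T' - S \<subseteq> W"
  obtains f g where "\<And>i. i < k \<Longrightarrow> f i \<in> F" "\<And>j. j < k - 1 \<Longrightarrow> g j \<in> F"
    "\<And>i j. \<lbrakk>i < k; j < k - 1\<rbrakk> \<Longrightarrow> f i \<subseteq> g j \<longleftrightarrow> i = j \<or> i = Suc j"
    "\<And>i. i < k \<Longrightarrow> y \<in> f i \<longleftrightarrow> 0 < i \<and> i < k - 1"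
proof -
  \<comment> \<open>The third and fourth clauses separate \<open>f i\<close> from later and from earlier sets \<open>g l\<close>,
    the fifth provides the next witness for the fourth. The last clause bounds the points that a
    random upward step has to avoid as its first new point.\<close>
  define inv where "inv j f g \<longleftrightarrow>
    (\<forall>i\<le>j. f i \<in> F \<and> g i \<in> F \<and> f i \<subseteq> g i \<and> (\<exists>S. (S, g i) \<in> E) \<and> (y \<in> f i \<longleftrightarrow> 0 < i)) \<and>
    (\<forall>i<j. f (Suc i) \<subseteq> g i) \<and>
    (\<forall>i<j. \<exists>x\<in>f i. \<forall>l. i < l \<and> l \<le> j \<longrightarrow> x \<notin> g l) \<and>
    (\<forall>i\<le>j. \<exists>x\<in>f i. \<forall>l. Suc l < i \<longrightarrow> x \<notin> g l) \<and>
    (\<exists>x\<in>g j. \<forall>l<j. x \<notin> g l) \<and>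
    card ((\<Union>l\<le>j. g l) - g j) \<le> j * d" for j and f g :: "nat \<Rightarrow> 'a set"
  have ex: "\<exists>f g. inv j f g" if "j \<le> k - 2" for j
    using that
  proof (induction j)
    case 0
    obtain S T where ST: "(S, T) \<in> E" using \<open>E \<noteq> {}\<close> by auto
    \<comment> \<open>Any point other than \<open>y\<close> serves here: it makes the left end
      nonempty, as the fourth clause demands.\<close>
    obtain x where "x \<in> T" "x \<noteq> y" using nontriv[OF ST] by blast
    then obtain R where R: "R \<in> F" "R \<subseteq> T" "y \<notin> R" "x \<in> R" using leave[OF ST] by blast
    have "T \<in> F" "\<exists>S. (S, T) \<in> E" "\<exists>z\<in>R. True" "\<exists>z\<in>T. True" using R ST EF by auto
    with R(1-3) have "inv 0 (\<lambda>_. R) (\<lambda>_. T)"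
      unfolding inv_def by simp
    then show ?case by blast
  next
    case (Suc j)
    then have "\<exists>f g. inv j f g" by simp
    then obtain f g where inv: "inv j f g" by blast
    note I = inv[unfolded inv_def]
    note I1 = I[THEN conjunct1, rule_format]
    note I2 = I[THEN conjunct2, THEN conjunct1, rule_format]
    note I3 = I[THEN conjunct2, THEN conjunct2, THEN conjunct1]
    note I4 = I[THEN conjunct2, THEN conjunct2, THEN conjunct2, THEN conjunct1]
    note I5 = I[THEN conjunct2, THEN conjunct2, THEN conjunct2, THEN conjunct2, THEN conjunct1]
    note I6 = I[THEN conjunct2, THEN conjunct2, THEN conjunct2, THEN conjunct2, THEN conjunct2]
    have fg: "f i \<in> F" "g i \<in> F" "f i \<subseteq> g i" "\<exists>S. (S, g i) \<in> E" "y \<in> f i \<longleftrightarrow> 0 < i" if "i \<le> j" for i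
      using I1[OF that] by simp_all
    have gU: "g i \<subseteq> U" if "i \<le> j" for i using fg(4)[OF that] edge by blast
    obtain S where S: "(S, g j) \<in> E" using fg(4) by blast
    obtain x where x: "x \<in> g j" "\<forall>l<j. x \<notin> g l" using I5 by blast
    \<comment> \<open>With \<open>g j - f j\<close> as the set \<open>W\<close>, the step down loses
      some point \<open>p\<close> of \<open>f j\<close>. If later upper sets avoid \<open>p\<close>,
      they do not contain \<open>f j\<close>. The point \<open>x\<close>, which is kept, separates
      \<open>S'\<close> from all \<open>g l\<close> with \<open>l < j\<close>.\<close>
    have "card (g j - f j) \<le> d" using fg by (intro diff) auto
    then obtain S' where S': "(S', g j) \<in> E" "x \<in> S'" "\<not> g j - S' \<subseteq> g j - f j"
      using down[OF S x(1), of "g j - f j"] by blast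
    then obtain p where p: "p \<in> f j" "p \<notin> S'" "p \<in> g j" by blast
    obtain P where P: "\<And>i. i < j \<Longrightarrow> P i \<in> f i \<and> (\<forall>l. i < l \<and> l \<le> j \<longrightarrow> P i \<notin> g l)"
      using I3 by metis
    \<comment> \<open>\<open>?Z\<close> collects the witnesses that \<open>T'\<close> must avoid in
      order to contain no earlier \<open>f i\<close>. Requiring a new point outside
      \<open>?W\<close> provides the fifth clause for \<open>T'\<close>.\<close>
    let ?Z = "insert p (P ` {..<j})" and ?W = "\<Union>l\<le>j. g l"
    have S'g: "S' \<subseteq> g j" "y \<in> S'" "S' \<in> F" using edge[OF S'(1)] S'(1) EF by auto
    have "?Z \<subseteq> U - S'"
    proof
      fix z assume "z \<in> ?Z"
      then consider "z = p" | i where "i < j" "z = P i" by blast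
      then show "z \<in> U - S'"
      proof cases
        case 1
        then show ?thesis using p gU by blast
      next
        case (2 i)
        then have "z \<in> U" using P[of i] fg(3)[of i] gU[of i] by auto
        moreover have "z \<notin> g j" using P[of i] 2 by blast
        ultimately show ?thesis using S'g by blast
      qed
    qed
    moreover have WU: "?W \<subseteq> U" using gU by blast
    moreover have "card ?Z \<le> k"
    proof -
      have "card ?Z \<le> Suc (card (P ` {..<j}))" by (rule card_insert_le_m1) auto
      also have "\<dots> \<le> Suc j" using card_image_le[of "{..<j}" P] by simp
      finally show ?thesis using Suc.prems k by linarith
    qed
    \<comment> \<open>The step down exposes at most \<open>d\<close> further points of the union.
      Since \<open>T'\<close> contains \<open>S'\<close>, the same bound later gives the last
      clause.\<close>
    moreover have Wd: "card (?W - S') \<le> Suc j * d"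
    proof -
      have "card (?W - S') \<le> card ((?W - g j) \<union> (g j - S'))"
        using WU \<open>finite U\<close> by (intro card_mono) (auto intro: finite_subset)
      also have "\<dots> \<le> card (?W - g j) + card (g j - S')" by (rule card_Un_le)
      also have "\<dots> \<le> j * d + d"
        using I6 fg(2) S'g by (intro add_mono diff) auto
      finally show ?thesis by simp
    qed
    moreover have "Suc j * d \<le> k * d" using Suc.prems k by (intro mult_right_mono) auto
    ultimately obtain T' where T': "(S', T') \<in> E" "T' \<inter> ?Z = {}" "\<not> T' - S' \<subseteq> ?W"
      using up[OF S'(1), of ?Z ?W] by (meson order.trans)
    have T'F: "T' \<in> F" "S' \<subseteq> T'" "T' \<subseteq> U" using edge[OF T'(1)] T'(1) EF by auto
    let ?f = "f(Suc j := S')" and ?g = "g(Suc j := T')"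
    have "\<forall>i\<le>Suc j. ?f i \<in> F \<and> ?g i \<in> F \<and> ?f i \<subseteq> ?g i \<and> (\<exists>S. (S, ?g i) \<in> E) \<and> (y \<in> ?f i \<longleftrightarrow> 0 < i)"
      using fg T' T'F S'g by (auto simp: le_Suc_eq)
    moreover have "\<forall>i<Suc j. ?f (Suc i) \<subseteq> ?g i"
      using I2 S'g by (auto simp: less_Suc_eq)
    moreover have "\<forall>i<Suc j. \<exists>x\<in>?f i. \<forall>l. i < l \<and> l \<le> Suc j \<longrightarrow> x \<notin> ?g l"
    proof (intro allI impI)
      fix i assume "i < Suc j"
      then consider "i = j" | "i < j" by linarith
      then show "\<exists>x\<in>?f i. \<forall>l. i < l \<and> l \<le> Suc j \<longrightarrow> x \<notin> ?g l"
      proof cases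
        case 1
        then show ?thesis using p T'(2) by (intro bexI[of _ p]) (auto simp: le_Suc_eq)
      next
        case 2
        then show ?thesis using P[OF 2] T'(2) by (intro bexI[of _ "P i"]) (auto simp: le_Suc_eq)
      qed
    qed
    moreover have "\<forall>i\<le>Suc j. \<exists>x\<in>?f i. \<forall>l. Suc l < i \<longrightarrow> x \<notin> ?g l"
    proof (intro allI impI)
      fix i assume "i \<le> Suc j"
      then consider "i = Suc j" | "i \<le> j" by linarith
      then show "\<exists>x\<in>?f i. \<forall>l. Suc l < i \<longrightarrow> x \<notin> ?g l"
      proof cases
        case 1
        then show ?thesis using x S' by (intro bexI[of _ x]) auto
      next
        case 2
        then obtain z where "z \<in> f i" "\<forall>l. Suc l < i \<longrightarrow> z \<notin> g l" using I4 by blast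
        then show ?thesis using 2 by (intro bexI[of _ z]) auto
      qed
    qed
    moreover have "\<exists>x\<in>?g (Suc j). \<forall>l<Suc j. x \<notin> ?g l"
    proof -
      obtain z where "z \<in> T'" "z \<notin> ?W" using T'(3) by blast
      then show ?thesis by (intro bexI[of _ z]) auto
    qed
    moreover have "card ((\<Union>l\<le>Suc j. ?g l) - ?g (Suc j)) \<le> Suc j * d"
    proof -
      have "(\<Union>l\<le>Suc j. ?g l) - ?g (Suc j) \<subseteq> ?W - S'" using T'F by (auto simp: le_Suc_eq)
      then have "card ((\<Union>l\<le>Suc j. ?g l) - ?g (Suc j)) \<le> card (?W - S')"
        using WU \<open>finite U\<close> by (intro card_mono) (auto intro: finite_subset)
      then show ?thesis using Wd by linarith
    qed
    ultimately have "inv (Suc j) ?f ?g" unfolding inv_def by (intro conjI)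
    then show ?case by blast
  qed
  then obtain f g where inv: "inv (k - 2) f g" by blast
  note I = inv[unfolded inv_def]
  note I1 = I[THEN conjunct1, rule_format]
  note I2 = I[THEN conjunct2, THEN conjunct1, rule_format]
  note I3 = I[THEN conjunct2, THEN conjunct2, THEN conjunct1]
  note I4 = I[THEN conjunct2, THEN conjunct2, THEN conjunct2, THEN conjunct1]
  note I5 = I[THEN conjunct2, THEN conjunct2, THEN conjunct2, THEN conjunct2, THEN conjunct1]
  note I6 = I[THEN conjunct2, THEN conjunct2, THEN conjunct2, THEN conjunct2, THEN conjunct2]
  have fg: "f i \<in> F" "g i \<in> F" "f i \<subseteq> g i" "\<exists>S. (S, g i) \<in> E" "y \<in> f i \<longleftrightarrow> 0 < i" if "i \<le> k - 2" for i
    using I1[OF that] by simp_all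
  have fS: "f (Suc i) \<subseteq> g i" if "i < k - 2" for i using I2[OF that] .
  obtain x where x: "x \<in> g (k - 2)" "\<forall>l<k-2. x \<notin> g l" using I5 by blast
  \<comment> \<open>Since \<open>0 < k - 2\<close>, the witness \<open>x\<close> avoids
    \<open>g 0\<close> and so differs from \<open>y\<close>. Therefore \<open>leave\<close> gives a
    right end that misses \<open>y\<close> but still contains \<open>x\<close>, which separates it
    from all earlier upper sets.\<close>
  have "y \<in> g 0" using fg(4)[of 0] edge by blast
  then have "x \<noteq> y" using x(2) k by auto
  moreover obtain S where S: "(S, g (k - 2)) \<in> E" using fg(4)[of "k - 2"] by blast
  ultimately obtain R where R: "R \<in> F" "R \<subseteq> g (k - 2)" "y \<notin> R" "x \<in> R" using leave[OF S x(1)] by blast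
  let ?f = "f(k - 1 := R)"
  show thesis
  proof (rule that[of ?f g])
    show "?f i \<in> F" if "i < k" for i using that fg(1)[of i] R by auto
    show "g j \<in> F" if "j < k - 1" for j using that fg(2)[of j] by auto
    show "y \<in> ?f i \<longleftrightarrow> 0 < i \<and> i < k - 1" if "i < k" for i
      using that fg(5)[of i] R k by auto
    show "?f i \<subseteq> g j \<longleftrightarrow> i = j \<or> i = Suc j" if ij: "i < k" "j < k - 1" for i j
    proof (cases "i = k - 1")
      case True
      consider "j = k - 2" | "j < k - 2" using ij by linarith
      then show ?thesis
      proof cases
        case 1
        then show ?thesis using True R k by auto
      next
        case 2
        then have "\<not> R \<subseteq> g j" using x(2) R by blast
        then show ?thesis using True 2 k by auto
      qed
    next
      case False
      then have i: "i \<le> k - 2" using ij by auto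
      consider "i = j" | "i = Suc j" | "i < j" | "Suc j < i" by linarith
      then show ?thesis
      proof cases
        case 1
        then show ?thesis using fg(3)[OF i] False by auto
      next
        case 2
        then show ?thesis using fS[of j] i False by auto
      next
        case 3
        then obtain z where "z \<in> f i" "z \<notin> g j"
        proof -
          have "i < k - 2" "j \<le> k - 2" using 3 ij by linarith+
          with I3[rule_format, of i] 3 that show thesis by blast
        qed
        then show ?thesis using 3 False by auto
      next
        case 4
        then obtain z where "z \<in> f i" "z \<notin> g j" using I4[rule_format, OF i] by blast
        then show ?thesis using 4 False by auto
      qed
    qed
  qed
qed

section \<open>Crowns from incidences, and rainbow crowns in dense families\<close>

text \<open>For indices in \<open>{1..k}\<close> the clause \<open>i = Suc j\<close> forces
  \<open>j < k\<close>; the last clause closes the cycle.\<close>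

definition crown_below :: "nat \<Rightarrow> nat \<Rightarrow> nat \<Rightarrow> bool" where
  "crown_below k i j \<longleftrightarrow> i = j \<or> i = Suc j \<or> (i = 1 \<and> j = k)"

lemma crown_order_iff:
  assumes "k \<ge> 3" "p \<in> crown_carrier k" "q \<in> crown_carrier k"
  shows "(p, q) \<in> crown_order k \<longleftrightarrow>
    p = q \<or> (\<exists>i j. p = A i \<and> q = B j \<and> crown_below k i j)"
  using assms unfolding crown_order_def crown_below_def crown_carrier_def by auto

text \<open>The incidences between the two levels determine all other relations. In a cycle of
  length \<open>2 * k \<ge> 6\<close>, distinct elements of one level have incomparable
  neighbourhoods, whereas an inclusion inside a level would make them nested. If
  \<open>h (B j)\<close> were below \<open>h (A i)\<close>, both lower neighbours of
  \<open>B j\<close> would be too.\<close>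

lemma strong_copy_crown:
  assumes k: "k \<ge> 3"
    and h: "\<And>i j. \<lbrakk>i \<in> {1..k}; j \<in> {1..k}\<rbrakk> \<Longrightarrow> h (A i) \<subseteq> h (B j) \<longleftrightarrow> crown_below k i j"
  shows "strong_copy (crown_carrier k) (crown_order k) (h ` crown_carrier k)"
proof -
  have AA: "i = i'" if i: "i \<in> {1..k}" "i' \<in> {1..k}" and sub: "h (A i) \<subseteq> h (A i')" for i i'
  proof -
    have t: "crown_below k i j" if "j \<in> {1..k}" "crown_below k i' j" for j
      using that i sub h[of i j] h[of i' j] by blast
    show ?thesis
    proof (cases "i' = 1")
      case True
      then show ?thesis using t[of 1] t[of k] i k by (auto simp: crown_below_def)
    next
      case False
      then show ?thesis using t[of i'] t[of "i' - 1"] i k unfolding crown_below_def by simp presburger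
    qed
  qed
  have BB: "j = j'" if j: "j \<in> {1..k}" "j' \<in> {1..k}" and sub: "h (B j) \<subseteq> h (B j')" for j j'
  proof -
    have t: "crown_below k i j'" if "i \<in> {1..k}" "crown_below k i j" for i
      using that j sub h[of i j] h[of i j'] by blast
    show ?thesis
    proof (cases "j = k")
      case True
      then show ?thesis using t[of 1] t[of k] j k by (auto simp: crown_below_def)
    next
      case False
      then show ?thesis using t[of j] t[of "Suc j"] j k by (auto simp: crown_below_def)
    qed
  qed
  have BA: "\<not> h (B j) \<subseteq> h (A i)" if ij: "j \<in> {1..k}" "i \<in> {1..k}" for i j
  proof
    assume sub: "h (B j) \<subseteq> h (A i)"
    obtain i' where i': "i' \<in> {1..k}" "i' \<noteq> j" "crown_below k i' j"
    proof (cases "j = k")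
      case True
      then show ?thesis using that[of 1] k by (auto simp: crown_below_def)
    next
      case False
      then show ?thesis using that[of "Suc j"] ij by (auto simp: crown_below_def)
    qed
    have "h (A j) \<subseteq> h (B j)" "h (A i') \<subseteq> h (B j)"
      using h ij i' by (auto simp: crown_below_def)
    then have "j = i" "i' = i" using AA ij i' sub by blast+
    then show False using i' by simp
  qed
  have ord: "(p, q) \<in> crown_order k \<longleftrightarrow> h p \<subseteq> h q"
    if pq: "p \<in> crown_carrier k" "q \<in> crown_carrier k" for p q
  proof (cases p; cases q)
    fix i i' assume "p = A i" "q = A i'"
    then show ?thesis unfolding crown_order_iff[OF k pq] using pq AA[of i i'] by (auto simp: crown_carrier_def)
  next
    fix i j assume "p = A i" "q = B j"
    then show ?thesis unfolding crown_order_iff[OF k pq] using pq h[of i j] by (auto simp: crown_carrier_def)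
  next
    fix i j assume "p = B j" "q = A i"
    then show ?thesis unfolding crown_order_iff[OF k pq] using pq BA[of j i] by (auto simp: crown_carrier_def)
  next
    fix j j' assume "p = B j" "q = B j'"
    then show ?thesis unfolding crown_order_iff[OF k pq] using pq BB[of j j'] by (auto simp: crown_carrier_def)
  qed
  have "inj_on h (crown_carrier k)"
  proof (rule inj_onI)
    fix p q assume pq: "p \<in> crown_carrier k" "q \<in> crown_carrier k" "h p = h q"
    then have "(p, q) \<in> crown_order k" "(q, p) \<in> crown_order k" using ord by auto
    then show "p = q" using crown_order_iff[OF k] pq by auto
  qed
  then show ?thesis
    unfolding strong_copy_def using ord by (intro exI[of _ h]) (auto intro: inj_on_imp_bij_betw)
qed

text \<open>As the central binomial coefficient is the largest, a set lies on at least
  \<open>fact n / C\<close> chains, so the size of \<open>F\<close> yields the density that the core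
  requires. The fence found in the core is closed by \<open>{1..n} - {y}\<close>; by
  \<open>inj\<close> and \<open>fresh\<close> the resulting crown is rainbow.\<close>

lemma dense_family_not_rainbow_free:
  fixes \<epsilon> :: real
  assumes k: "3 \<le> k" and F: "F \<subseteq> Pow {1..n}" and lev: "\<And>S. S \<in> F \<Longrightarrow> m \<le> card S \<and> card S \<le> M"
    and \<epsilon>: "0 < \<epsilon>" "\<epsilon> \<le> 1"
    and big: "(1 + \<epsilon>) * real (n choose (n div 2)) \<le> card F"
    and m: "2 \<le> m" "n \<le> 4 * m" "M < n" "16 * real (M - m) \<le> \<epsilon> * (real m - 1)"
    and down: "2 * real (M - m) < \<epsilon>\<^sup>2 / 512 * m"
    and up: "2 * real k * real (M - m) < \<epsilon>\<^sup>2 / 512 * real (n - M)"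
    and inj: "inj_on c F" and fresh: "\<And>y. y \<in> {1..n} \<Longrightarrow> c ({1..n} - {y}) \<notin> c ` F"
  shows "\<not> rainbow_free_coloring n (crown_carrier k) (crown_order k) c"
proof -
  define \<theta> where "\<theta> = \<epsilon>\<^sup>2 / 512"
  have \<theta>0: "\<theta> > 0" using \<epsilon> by (simp add: \<theta>_def)
  define C where "C = real (n choose (n div 2))"
  have C0: "C > 0" by (simp add: C_def zero_less_binomial_iff)
  have "fact n / C \<le> real (card (thru n S))" if "S \<in> F" for S
  proof -
    have "S \<subseteq> {1..n}" using that F by auto
    then have "real (card (thru n S)) * real (n choose card S) = fact n"
      using card_thru by (metis of_nat_fact of_nat_mult)
    moreover have "real (card (thru n S)) * real (n choose card S) \<le> real (card (thru n S)) * C"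
      using binomial_maximum[of n "card S"] unfolding C_def by (intro mult_left_mono) auto
    ultimately show ?thesis using C0 by (simp add: divide_le_eq)
  qed
  then have "real (card F) * (fact n / C) \<le> (\<Sum>S\<in>F. real (card (thru n S)))"
    by (rule sum_bounded_below)
  moreover have "(1 + \<epsilon>) * C * (fact n / C) \<le> real (card F) * (fact n / C)"
    using big C0 unfolding C_def by (intro mult_right_mono) auto
  ultimately have tot: "(1 + \<epsilon>) * fact n \<le> (\<Sum>S\<in>F. real (card (thru n S)))" using C0 by simp
  obtain y E where y: "y \<in> {1..n}" and E: "E \<noteq> {}" "E \<subseteq> F \<times> F"
    and e: "\<And>S T. (S, T) \<in> E \<Longrightarrow> S \<subset> T \<and> y \<in> S \<and> y \<in> separable F T"
    and eup: "\<And>S T. (S, T) \<in> E \<Longrightarrow> \<theta> * card (thru n S) \<le> card {\<sigma>\<in>thru n S. \<exists>T. (S, T) \<in> E \<and> \<sigma> \<in> thru n T}"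
    and edown: "\<And>S T. (S, T) \<in> E \<Longrightarrow> \<theta> * card (thru n T) \<le> card {\<sigma>\<in>thru n T. \<exists>S. (S, T) \<in> E \<and> \<sigma> \<in> thru n S}"
    by (rule exists_core[OF F lev \<epsilon> tot m(1,2,4), folded \<theta>_def], assumption, rule that)
  have sub: "S \<subseteq> {1..n}" if "S \<in> F" for S using that F by auto
  have EF: "S \<in> F \<and> T \<in> F" if "(S, T) \<in> E" for S T using that E by auto
  have f: "finite S" if "S \<in> F" for S using finite_subset[OF sub[OF that]] by simp
  obtain f g where fF: "\<And>i. i < k \<Longrightarrow> f i \<in> F" and gF: "\<And>j. j < k - 1 \<Longrightarrow> g j \<in> F"
    and fg: "\<And>i j. \<lbrakk>i < k; j < k - 1\<rbrakk> \<Longrightarrow> f i \<subseteq> g j \<longleftrightarrow> i = j \<or> i = Suc j"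
    and fy: "\<And>i. i < k \<Longrightarrow> y \<in> f i \<longleftrightarrow> 0 < i \<and> i < k - 1"
  proof (rule exists_fence[OF k E, of "{1..n}" y "M - m"])
    show "S \<subseteq> T \<and> T \<subseteq> {1..n} \<and> y \<in> S" if "(S, T) \<in> E" for S T
      using e[OF that] EF[OF that] sub by blast
    show "card (T - S) \<le> M - m" if "S \<in> F" "T \<in> F" "S \<subseteq> T" for S T
    proof -
      have "card (T - S) = card T - card S" using that f by (intro card_Diff_subset) auto
      then show ?thesis using lev[OF that(1)] lev[OF that(2)] by linarith
    qed
    show "\<exists>R\<in>F. R \<subseteq> T \<and> y \<notin> R \<and> x \<in> R" if "(S, T) \<in> E" "x \<in> T" "x \<noteq> y" for S T x
    proof -
      have "\<exists>R\<in>F. R \<subset> T \<and> y \<notin> R \<and> x \<in> R"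
        using e[OF that(1)] that(2,3) by (simp add: separable_def)
      then show ?thesis by blast
    qed
    show "\<exists>x\<in>T. x \<noteq> y" if "(S, T) \<in> E" for S T
    proof -
      have "2 \<le> card T" using EF[OF that] lev[of T] m(1) by linarith
      then have "\<not> T \<subseteq> {y}" using card_mono[of "{y}" T] by auto
      then show ?thesis by blast
    qed
    show "\<exists>S'. (S', T) \<in> E \<and> x \<in> S' \<and> \<not> T - S' \<subseteq> W"
      if ST: "(S, T) \<in> E" "x \<in> T" "W \<subseteq> T" "card W \<le> M - m" for S T x W
    proof (rule exists_lower_avoiding[where m = m])
      show "T \<subseteq> {1..n}" using EF[OF ST(1)] sub by blast
      show "\<theta> * card (thru n T) \<le> card {\<sigma>\<in>thru n T. \<exists>S. (S, T) \<in> E \<and> \<sigma> \<in> thru n S}"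
        by (rule edown[OF ST(1)])
      show "S' \<subset> T \<and> m \<le> card S'" if "(S', T) \<in> E" for S'
        using e[OF that] EF[OF that] lev by blast
      \<comment> \<open>At most \<open>M - m\<close> positions for \<open>x\<close> and at most
        \<open>M - m\<close> points of \<open>W\<close> give the factor 2 in \<open>down\<close>. In
        the step up both terms are at most \<open>k * (M - m)\<close>.\<close>
      have "card T - m + card W \<le> 2 * (M - m)"
        using ST(4) lev[of T] EF[OF ST(1)] by linarith
      then have "real (card T - m + card W) \<le> real (2 * (M - m))" by (rule of_nat_mono)
      then have "real (card T - m) + card W \<le> 2 * real (M - m)" by simp
      also have "\<dots> < \<theta> * m" using down by (simp add: \<theta>_def)
      also have "\<dots> \<le> \<theta> * card T" using \<theta>0 lev[of T] EF[OF ST(1)] by simp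
      finally show "real (card T - m) + card W < \<theta> * card T" .
    qed (use ST in auto)
    show "\<exists>T'. (S, T') \<in> E \<and> T' \<inter> Z = {} \<and> \<not> T' - S \<subseteq> W"
      if ST: "(S, T) \<in> E" "Z \<subseteq> {1..n} - S" "W \<subseteq> {1..n}" "card Z \<le> k" "card (W - S) \<le> k * (M - m)"
      for S T Z W
    proof (rule exists_upper_avoiding[where M = M])
      have S: "S \<in> F" "m \<le> card S" "card S \<le> M" using EF[OF ST(1)] lev by auto
      show "S \<subseteq> {1..n}" using S sub by blast
      show "\<theta> * card (thru n S) \<le> card {\<sigma>\<in>thru n S. \<exists>T. (S, T) \<in> E \<and> \<sigma> \<in> thru n T}"
        by (rule eup[OF ST(1)])
      show "S \<subset> T' \<and> card T' \<le> M" if "(S, T') \<in> E" for T'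
        using e[OF that] EF[OF that] lev by blast
      show "M \<le> n" "card S < n" using S m by auto
      have "card Z * (M - card S) \<le> k * (M - m)" using ST(4) S by (intro mult_mono) auto
      then have "card Z * (M - card S) + card (W - S) \<le> 2 * k * (M - m)" using ST(5) by simp
      then have "real (card Z * (M - card S) + card (W - S)) \<le> real (2 * k * (M - m))"
        by (rule of_nat_mono)
      then have "real (card Z * (M - card S)) + card (W - S) \<le> 2 * real k * real (M - m)" by simp
      also have "\<dots> < \<theta> * real (n - M)" using up by (simp add: \<theta>_def)
      also have "\<dots> \<le> \<theta> * real (n - card S)" using \<theta>0 S by (intro mult_left_mono of_nat_mono) auto
      finally show "real (card Z * (M - card S)) + card (W - S) < \<theta> * real (n - card S)" .
    qed (use ST in auto)
  qed (rule finite_atLeastAtMost, rule that)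
  let ?X = "{1..n} - {y}"
  \<comment> \<open>The fence is indexed from 0 and the crown from 1. The ends \<open>f 0\<close>
    and \<open>f (k - 1)\<close>, the only lower sets missing \<open>y\<close>, become
    \<open>A 1\<close> and \<open>A k\<close>, which lie below \<open>B k\<close>.\<close>
  define h where "h p = (case p of A i \<Rightarrow> f (i - 1) | B j \<Rightarrow> if j = k then ?X else g (j - 1))" for p
  let ?H = "h ` crown_carrier k"
  have "strong_copy (crown_carrier k) (crown_order k) ?H"
  proof (rule strong_copy_crown[OF k])
    fix i j assume ij: "i \<in> {1..k}" "j \<in> {1..k}"
    show "h (A i) \<subseteq> h (B j) \<longleftrightarrow> crown_below k i j"
    proof (cases "j = k")
      case True
      have lt: "i - 1 < k" using ij k by auto
      have "f (i - 1) \<subseteq> {1..n}" by (rule sub[OF fF[OF lt]])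
      then have "f (i - 1) \<subseteq> ?X \<longleftrightarrow> \<not> (0 < i - 1 \<and> i - 1 < k - 1)" unfolding fy[OF lt, symmetric] by blast
      also have "\<dots> \<longleftrightarrow> crown_below k i j" using True ij unfolding crown_below_def by auto
      finally show ?thesis using True by (simp add: h_def)
    next
      case False
      then have lt: "i - 1 < k" "j - 1 < k - 1" using ij by auto
      have "i - 1 = j - 1 \<or> i - 1 = Suc (j - 1) \<longleftrightarrow> crown_below k i j"
        using False ij unfolding crown_below_def by auto
      then show ?thesis using fg[OF lt] False by (simp add: h_def)
    qed
  qed
  moreover have HF: "?H \<subseteq> insert ?X F"
  proof
    fix S assume "S \<in> ?H"
    then obtain p where p: "p \<in> crown_carrier k" "S = h p" by (rule imageE)
    show "S \<in> insert ?X F"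
    proof (cases p)
      case (A i)
      then have "i - 1 < k" using p by (auto simp: crown_carrier_def)
      then show ?thesis using A p fF by (simp add: h_def)
    next
      case (B j)
      then have "j \<noteq> k \<Longrightarrow> j - 1 < k - 1" using p by (auto simp: crown_carrier_def)
      then show ?thesis using B p gF by (cases "j = k") (simp_all add: h_def)
    qed
  qed
  moreover have "rainbow c ?H"
    unfolding rainbow_def
    by (rule inj_on_subset[OF _ HF]) (use inj fresh[OF y] in auto)
  moreover have "?H \<subseteq> Pow {1..n}" using HF F by blast
  ultimately show ?thesis unfolding rainbow_free_coloring_def by blast
qed

section \<open>Binomial tails and bounds for the anti-Ramsey number\<close>

text \<open>The ratio of the two coefficients is \<open>(n - i) / (i + 1)\<close>, here at most
  \<open>(h + 1 - s) / (h + 1) = 1 - s / (h + 1)\<close>.\<close>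

lemma binomial_decay:
  fixes r :: real
  assumes "i < n" "n \<le> 2 * h + 1" "h + s \<le> i" "1 - r \<le> real s / real (h + 1)" "s \<le> h"
  shows "real (n choose Suc i) \<le> r * real (n choose i)"
proof -
  have "(real n - real i) * (real h + 1) \<le> (real h + 1 - real s) * (real h + 1)"
    using assms by (intro mult_right_mono) auto
  also have "\<dots> \<le> (real h + 1 - real s) * (real i + 1)"
    using assms by (intro mult_left_mono) auto
  finally have "(real n - real i) / (real i + 1) \<le> (real h + 1 - real s) / (real h + 1)"
    by (simp add: divide_simps)
  also have "\<dots> \<le> r" using assms(4) by (simp add: field_simps)
  finally have r: "(real n - real i) / (real i + 1) \<le> r" .
  have "Suc i * (n choose Suc i) = (n - i) * (n choose i)"
    using binomial_absorb_comp[of n i] binomial_absorption[of i n] by simp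
  then have "real (Suc i) * (n choose Suc i) = real (n - i) * (n choose i)"
    by (metis of_nat_mult)
  then have "real (n choose Suc i) = (real n - real i) / (real i + 1) * (n choose i)"
    using assms(1) by (simp add: field_simps of_nat_diff)
  also have "\<dots> \<le> r * (n choose i)" using r by (intro mult_right_mono) auto
  finally show ?thesis .
qed

lemma binomial_tail_power:
  fixes r :: real
  assumes "1 - r \<le> real s / real (n div 2 + 1)" "s \<le> n div 2" "0 \<le> r"
  shows "real (n choose (n div 2 + s + j)) \<le> r ^ j * real (n choose (n div 2))"
proof (induction j)
  case 0
  then show ?case using binomial_maximum[of n "n div 2 + s"] by simp
next
  case (Suc j)
  show ?case
  proof (cases "n div 2 + s + j < n")
    case True
    have "real (n choose Suc (n div 2 + s + j)) \<le> r * real (n choose (n div 2 + s + j))"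
      using True assms by (intro binomial_decay[OF _ _ _ assms(1)]) auto
    also have "\<dots> \<le> r * (r ^ j * real (n choose (n div 2)))"
      using Suc assms by (intro mult_left_mono) auto
    finally show ?thesis by (simp add: mult.assoc)
  next
    case False
    then show ?thesis using assms by (simp add: binomial_eq_0)
  qed
qed

text \<open>The first \<open>s\<close> levels above the middle bring the ratio of consecutive
  coefficients down to \<open>r\<close>, and the next \<open>s\<close> levels gain the factor
  \<open>r ^ s\<close>. Levels below the middle follow by symmetry, and there are at most
  \<open>n + 1\<close> levels.\<close>

lemma card_outside_middle:
  fixes r :: real
  assumes "1 - r \<le> real s / real (n div 2 + 1)" "s \<le> n div 2" "0 \<le> r" "r \<le> 1"
  shows "real (card {S\<in>Pow {1..n}. \<not> (n div 2 - 2 * s \<le> card S \<and> card S \<le> n div 2 + 2 * s)})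
    \<le> (real n + 1) * r ^ s * real (n choose (n div 2))"
proof -
  let ?h = "n div 2"
  let ?I = "{i. i \<le> n \<and> \<not> (?h - 2 * s \<le> i \<and> i \<le> ?h + 2 * s)}"
  have upper: "real (n choose i) \<le> r ^ s * real (n choose ?h)" if "?h + 2 * s \<le> i" for i
  proof -
    have "real (n choose (?h + s + (i - ?h - s))) \<le> r ^ (i - ?h - s) * real (n choose ?h)"
      by (rule binomial_tail_power[OF assms(1-3)])
    also have "\<dots> \<le> r ^ s * real (n choose ?h)"
      using that assms by (intro mult_right_mono power_decreasing) auto
    finally show ?thesis using that by simp
  qed
  have bound: "real (n choose i) \<le> r ^ s * real (n choose ?h)" if "i \<in> ?I" for i
  proof (cases "?h + 2 * s \<le> i")
    case False
    then have "?h + 2 * s \<le> n - i" "i \<le> n" using that by auto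
    then show ?thesis using upper[of "n - i"] binomial_symmetric[of i n] by simp
  qed (rule upper)
  have "{S\<in>Pow {1..n}. \<not> (?h - 2 * s \<le> card S \<and> card S \<le> ?h + 2 * s)}
      \<subseteq> (\<Union>i\<in>?I. {S. S \<subseteq> {1..n} \<and> card S = i})" (is "?L \<subseteq> _")
  proof
    fix S assume S: "S \<in> ?L"
    then have "card S \<le> n" using card_mono[of "{1..n}" S] by simp
    with S show "S \<in> (\<Union>i\<in>?I. {S. S \<subseteq> {1..n} \<and> card S = i})" by blast
  qed
  then have "card ?L \<le> card (\<Union>i\<in>?I. {S. S \<subseteq> {1..n} \<and> card S = i})"
    by (intro card_mono) auto
  also have "\<dots> \<le> (\<Sum>i\<in>?I. card {S. S \<subseteq> {1..n} \<and> card S = i})"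
    by (rule card_UN_le) simp
  also have "\<dots> = (\<Sum>i\<in>?I. n choose i)" by (simp add: n_subsets)
  finally have "real (card ?L) \<le> real (\<Sum>i\<in>?I. n choose i)" by (rule of_nat_mono)
  then have "real (card ?L) \<le> (\<Sum>i\<in>?I. real (n choose i))" by simp
  also have "\<dots> \<le> (\<Sum>i\<in>?I. r ^ s * real (n choose ?h))" by (intro sum_mono bound)
  also have "\<dots> = card ?I * (r ^ s * real (n choose ?h))" by simp
  also have "\<dots> \<le> card {..n} * (r ^ s * real (n choose ?h))"
    using assms by (intro mult_right_mono of_nat_mono card_mono) auto
  finally show ?thesis by (simp add: mult.assoc add.commute)
qed

lemma eventually_card_outside_middle:
  fixes \<delta> :: real
  assumes "0 < \<delta>" "2 \<le> D"
  shows "\<forall>\<^sub>F n in sequentially. real (card {S\<in>Pow {1..n}.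
    \<not> (n div 2 - 2 * (n div D) \<le> card S \<and> card S \<le> n div 2 + 2 * (n div D))})
    \<le> \<delta> * real (n choose (n div 2))"
proof -
  define r :: real where "r = 1 - 1 / D"
  have r: "0 \<le> r" "r < 1" using assms by (auto simp: r_def)
  \<comment> \<open>With \<open>q = n div D\<close>, this is \<open>D * (q + 1) * r ^ q\<close>,
    which dominates \<open>(n + 1) * r ^ q\<close>.\<close>
  have "(\<lambda>q. of_nat D * (of_nat q * r ^ q) + of_nat D * r ^ q) \<longlonglongrightarrow> of_nat D * 0 + of_nat D * 0"
    using r by (intro tendsto_intros powser_times_n_limit_0 LIMSEQ_power_zero) auto
  then have "\<forall>\<^sub>F q in sequentially. real D * (real q * r ^ q) + real D * r ^ q < \<delta>"
    using assms by (intro order_tendstoD) auto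
  then have "\<forall>\<^sub>F n in sequentially. real D * (real (n div D) * r ^ (n div D)) + real D * r ^ (n div D) < \<delta>"
    by (rule eventually_compose_filterlim[OF _ filterlim_at_top_div_const_nat]) (use assms in auto)
  then show ?thesis
    using eventually_ge_at_top[of "4 * D + 4"]
  proof eventually_elim
    case (elim n)
    let ?s = "n div D"
    have nD_nat: "n < D * ?s + D"
    proof -
      have "n = D * ?s + n mod D" by simp
      moreover have "n mod D < D" using assms by simp
      ultimately show ?thesis by linarith
    qed
    then have "real n < real (D * ?s + D)" by (simp only: of_nat_less_iff)
    then have nD: "real n < D * ?s + D" by simp
    \<comment> \<open>Rounding in \<open>n div D\<close> loses less than \<open>D\<close>, which
      \<open>n \<ge> 4 * D + 4\<close> compensates. This is what makes \<open>r = 1 - 1 / D\<close>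
      admissible.\<close>
    have "real (n div 2 + 1) \<le> D * ?s"
    proof -
      have "real (n div 2) \<le> n / 2" by simp
      moreover have "real n \<ge> real (4 * D + 4)" using elim(2) by (simp only: of_nat_le_iff)
      ultimately show ?thesis using nD by simp
    qed
    then have "1 - r \<le> ?s / real (n div 2 + 1)"
      using assms by (simp add: r_def field_simps)
    then have "real (card {S\<in>Pow {1..n}. \<not> (n div 2 - 2 * ?s \<le> card S \<and> card S \<le> n div 2 + 2 * ?s)})
        \<le> (real n + 1) * r ^ ?s * real (n choose (n div 2))"
      using r assms by (intro card_outside_middle div_le_mono2) auto
    also have "\<dots> \<le> \<delta> * real (n choose (n div 2))"
    proof (intro mult_right_mono)
      have "n + 1 \<le> D * ?s + D" using nD_nat by simp
      then have "real (n + 1) \<le> real (D * ?s + D)" by (simp only: of_nat_le_iff)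
      then have "real n + 1 \<le> D * ?s + D" by simp
      then have "(real n + 1) * r ^ ?s \<le> (D * ?s + D) * r ^ ?s"
        using r by (intro mult_right_mono) auto
      also have "\<dots> \<le> \<delta>" using elim(1) by (simp add: algebra_simps)
      finally show "(real n + 1) * r ^ ?s \<le> \<delta>" .
    qed simp
    finally show ?case .
  qed
qed

section \<open>Lower and upper bounds for the anti-Ramsey number\<close>

text \<open>The pairs \<open>A 1\<close>, \<open>B 1\<close> and \<open>A 2\<close>,
  \<open>B 2\<close> are disjoint and comparable. Each has a set outside the middle level, so the
  color 0, which \<open>Suc\<close> reserves for such sets, occurs twice in every crown.\<close>

lemma ar_star_crown_ge:
  assumes "2 \<le> k"
  shows "n choose (n div 2) \<le> ar_star n (crown_carrier k) (crown_order k)"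
proof -
  let ?L = "{S. S \<subseteq> {1..n} \<and> card S = n div 2}"
  have finL: "finite ?L" by simp
  obtain e :: "nat set \<Rightarrow> nat" where e: "inj_on e ?L"
    using finite_imp_inj_to_nat_seg[OF finL] by blast
  define c where "c S = (if S \<in> ?L then Suc (e S) else 0)" for S
  have free: "rainbow_free_coloring n (crown_carrier k) (crown_order k) c"
    unfolding rainbow_free_coloring_def
  proof
    assume "\<exists>G\<subseteq>Pow {1..n}. strong_copy (crown_carrier k) (crown_order k) G \<and> rainbow c G"
    then obtain G f where G: "G \<subseteq> Pow {1..n}" "inj_on c G" "bij_betw f (crown_carrier k) G"
      and ord: "\<And>p q. \<lbrakk>p \<in> crown_carrier k; q \<in> crown_carrier k\<rbrakk> \<Longrightarrow> (p, q) \<in> crown_order k \<longleftrightarrow> f p \<subseteq> f q"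
      unfolding strong_copy_def rainbow_def by blast
    have mem: "A i \<in> crown_carrier k" "B i \<in> crown_carrier k" if "i \<in> {1, 2}" for i
      using that assms by (auto simp: crown_carrier_def)
    have inj: "p = q" if "p \<in> crown_carrier k" "q \<in> crown_carrier k" "c (f p) = c (f q)" for p q
      using that G by (metis (no_types) bij_betw_apply bij_betw_imp_inj_on inj_onD)
    have low: "\<exists>p\<in>{A i, B i}. c (f p) = 0" if i: "i \<in> {1, 2}" for i
    proof (rule ccontr)
      assume "\<not> ?thesis"
      then have L: "f (A i) \<in> ?L" "f (B i) \<in> ?L" by (auto simp: c_def split: if_splits)
      have "(A i, B i) \<in> crown_order k"
        using i assms by (cases "i = k") (auto simp: crown_order_def)
      then have "f (A i) \<subseteq> f (B i)" using ord mem[OF i] by blast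
      moreover have "finite (f (B i))" using L(2) finite_subset by blast
      ultimately have "f (A i) = f (B i)" using L by (intro card_subset_eq) auto
      then show False using inj[of "A i" "B i"] mem[OF i] by auto
    qed
    obtain p q where "p \<in> {A 1, B 1}" "q \<in> {A 2, B 2}" "c (f p) = 0" "c (f q) = 0"
      using low[of 1] low[of 2] by auto
    then show False using inj[of p q] mem[of 1] mem[of 2] by auto
  qed
  have "inj_on c ?L" using e by (auto simp: inj_on_def c_def)
  then have "n choose (n div 2) = card (c ` ?L)"
    by (simp add: card_image n_subsets)
  also have "\<dots> \<le> card (c ` Pow {1..n})" by (intro card_mono) auto
  also have "\<dots> \<le> ar_star n (crown_carrier k) (crown_order k)"
    unfolding ar_star_def by (rule Max_ge[OF finite_color_counts]) (use free in blast)
  finally show ?thesis .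
qed

lemma ar_star_attained:
  assumes "p \<in> P" "q \<in> P" "p \<noteq> q"
  obtains c where "rainbow_free_coloring n P le c" "ar_star n P le = card (c ` Pow {1..n})"
proof -
  have "ar_star n P le \<in> {card (c ` Pow {1..n}) | c. rainbow_free_coloring n P le c}"
    unfolding ar_star_def
    by (rule Max_in[OF finite_color_counts]) (use rainbow_free_coloring_const[OF assms] in blast)
  then show thesis using that by blast
qed

text \<open>The central coefficient is at least \<open>n choose 2\<close>, which is quadratic in
  \<open>n\<close>. This absorbs the at most \<open>n\<close> representatives that clash with a set
  \<open>{1..n} - {y}\<close>.\<close>

lemma eventually_le_central_binomial:
  fixes \<delta> :: real
  assumes "0 < \<delta>"
  shows "\<forall>\<^sub>F n in sequentially. real n \<le> \<delta> * real (n choose (n div 2))"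
  using eventually_ge_at_top[of "nat \<lceil>2 / \<delta>\<rceil> + 1"]
proof eventually_elim
  case (elim n)
  have "1 \<le> n" "2 / \<delta> \<le> real n - 1" using elim by linarith+
  then have d: "2 \<le> \<delta> * (real n - 1)" using assms by (simp add: field_simps)
  have "2 * (n choose 2) = n * (n - 1)"
    using times_binomial_minus1_eq[of 2 n] by simp
  then have "2 * real (n choose 2) = real n * (real n - 1)"
    using \<open>1 \<le> n\<close> by (metis of_nat_1 of_nat_diff of_nat_mult of_nat_numeral)
  then have "\<delta> * real (n choose 2) = real n * (\<delta> * (real n - 1)) / 2" by simp
  also have "\<dots> \<ge> real n * 2 / 2" using d by (intro divide_right_mono mult_left_mono) auto
  finally have "real n \<le> \<delta> * real (n choose 2)" by simp
  also have "\<dots> \<le> \<delta> * real (n choose (n div 2))"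
    using assms binomial_maximum[of n 2] by (intro mult_left_mono of_nat_mono) auto
  finally show ?case .
qed

text \<open>Of the \<open>3 * \<epsilon>\<close> in the assumed excess, one
  \<open>\<epsilon>\<close> pays for representatives outside the middle levels, one for those that
  clash with a set \<open>{1..n} - {y}\<close>, and one is left as the density excess of
  \<open>F\<close>.\<close>

lemma eventually_ar_star_crown_le:
  fixes \<epsilon> :: real
  assumes k: "3 \<le> k" and \<epsilon>: "0 < \<epsilon>" "\<epsilon> \<le> 1"
  shows "\<forall>\<^sub>F n in sequentially. real (ar_star n (crown_carrier k) (crown_order k))
    \<le> (1 + 3 * \<epsilon>) * real (n choose (n div 2))"
proof -
  define \<theta> where "\<theta> = \<epsilon>\<^sup>2 / 512"
  have \<theta>0: "\<theta> > 0" using \<epsilon> by (simp add: \<theta>_def)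
  \<comment> \<open>The summand 64 keeps both \<open>m\<close> and \<open>n - M\<close> above
    \<open>n / 4\<close>. The second gives the bound on \<open>M - m\<close> that the core requires,
    and the third gives the smallness conditions for steps down and up.\<close>
  obtain D :: nat where D: "64 + 256 / \<epsilon> + 32 * real k / \<theta> < D"
    using reals_Archimedean2 by blast
  have D': "64 < real D" "256 / \<epsilon> < D" "32 * real k / \<theta> < D"
  proof -
    have "0 < 256 / \<epsilon>" "0 \<le> 32 * real k / \<theta>" using \<epsilon> \<theta>0 by simp_all
    then show "64 < real D" "256 / \<epsilon> < D" "32 * real k / \<theta> < D" using D by linarith+
  qed
  have D\<epsilon>: "256 \<le> \<epsilon> * D" and D\<theta>: "32 * real k \<le> \<theta> * D"
    using D' \<epsilon> \<theta>0 by (simp_all add: field_simps)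
  have "2 \<le> D" using D'(1) by simp
  show ?thesis
    using eventually_card_outside_middle[OF \<epsilon>(1) \<open>2 \<le> D\<close>] eventually_le_central_binomial[OF \<epsilon>(1)]
      eventually_ge_at_top[of 64]
  proof eventually_elim
    case (elim n)
    let ?P = "crown_carrier k" and ?le = "crown_order k"
    define C where "C = real (n choose (n div 2))"
    define s where "s = n div D"
    define m where "m = n div 2 - 2 * s"
    define M where "M = n div 2 + 2 * s"
    define Out where "Out = {S\<in>Pow {1..n}. \<not> (m \<le> card S \<and> card S \<le> M)}"
    have out: "real (card Out) \<le> \<epsilon> * C" using elim(1) by (simp add: Out_def m_def M_def s_def C_def)
    have nC: "real n \<le> \<epsilon> * C" using elim(2) by (simp add: C_def)
    have "D * s \<le> n" by (simp add: s_def)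
    then have "real (D * s) \<le> real n" by (rule of_nat_mono)
    then have Ds: "real D * s \<le> n" by simp
    have "64 * real s \<le> real D * s" using D'(1) by (intro mult_right_mono) auto
    then have "64 * real s \<le> n" using Ds by linarith
    then have sn: "64 * s \<le> n" by linarith
    have ms: "M - m = 4 * s" using sn by (simp add: M_def m_def)
    have m4: "n + 8 \<le> 4 * m" using sn elim(3) by (simp add: m_def)
    have M4: "n + 8 \<le> 4 * (n - M)" "M < n" using sn elim(3) by (simp_all add: M_def)
    have \<epsilon>s: "256 * real s \<le> \<epsilon> * n"
    proof -
      have "256 * real s \<le> \<epsilon> * D * s" using D\<epsilon> by (intro mult_right_mono) auto
      also have "\<dots> \<le> \<epsilon> * n" using Ds \<epsilon> by (simp add: mult.assoc)
      finally show ?thesis .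
    qed
    have \<theta>s: "32 * real k * s \<le> \<theta> * n"
    proof -
      have "32 * real k * real s \<le> \<theta> * D * s" using D\<theta> by (intro mult_right_mono) auto
      also have "\<dots> \<le> \<theta> * n" using Ds \<theta>0 by (simp add: mult.assoc)
      finally show ?thesis .
    qed
    show "real (ar_star n ?P ?le) \<le> (1 + 3 * \<epsilon>) * real (n choose (n div 2))"
    proof (rule ccontr)
      assume "\<not> ?thesis"
      then have large: "(1 + 3 * \<epsilon>) * C < ar_star n ?P ?le" by (simp add: C_def)
      have "A 1 \<in> ?P" "B 1 \<in> ?P" using k by (auto simp: crown_carrier_def)
      then obtain c where free: "rainbow_free_coloring n ?P ?le c"
        and ar: "ar_star n ?P ?le = card (c ` Pow {1..n})"
        by (rule ar_star_attained) simp
      obtain R where R: "R \<subseteq> Pow {1..n}" "inj_on c R" "c ` Pow {1..n} = c ` R"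
        using subset_image_inj[of "c ` Pow {1..n}" c "Pow {1..n}"] by auto
      have finR: "finite R" using R(1) by (rule finite_subset) simp
      let ?X = "(\<lambda>y. {1..n} - {y}) ` {1..n}"
      \<comment> \<open>As \<open>c\<close> is injective on \<open>R\<close>, at most one
        representative is lost for each of the \<open>n\<close> sets in \<open>?X\<close>.\<close>
      define Clash where "Clash = {S\<in>R. c S \<in> c ` ?X}"
      have "card Clash = card (c ` Clash)"
        using R(2) by (intro card_image[symmetric]) (auto simp: Clash_def intro: inj_on_subset)
      also have "\<dots> \<le> card (c ` ?X)" by (intro card_mono) (auto simp: Clash_def)
      also have "\<dots> \<le> card {1..n}" by (intro order.trans[OF card_image_le card_image_le]) auto
      finally have clash: "card Clash \<le> n" by simp
      define F where "F = R - Out - Clash"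
      have "card R \<le> card (F \<union> Out \<union> Clash)"
        using finR by (intro card_mono) (auto simp: F_def Out_def Clash_def)
      also have "\<dots> \<le> card F + card Out + card Clash"
        by (intro order.trans[OF card_Un_le] add_mono card_Un_le order.refl)
      finally have "real (card R) \<le> real (card F + card Out + card Clash)" by (rule of_nat_mono)
      moreover have "real (card R) = ar_star n ?P ?le" using ar R by (simp add: card_image)
      ultimately have "(1 + 3 * \<epsilon>) * C < real (card F) + real (card Out) + real (card Clash)"
        using large by simp
      moreover have "real (card Clash) \<le> \<epsilon> * C" using clash nC by linarith
      ultimately have big: "(1 + \<epsilon>) * C \<le> card F" using out by (simp add: algebra_simps)
      have "\<not> rainbow_free_coloring n ?P ?le c"
      proof (rule dense_family_not_rainbow_free[OF k _ _ \<epsilon>, of F n m M])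
        show "F \<subseteq> Pow {1..n}" using R by (auto simp: F_def)
        show "m \<le> card S \<and> card S \<le> M" if "S \<in> F" for S
        proof -
          have "S \<in> Pow {1..n}" "S \<notin> Out" using that R(1) by (auto simp: F_def)
          then show ?thesis unfolding Out_def by blast
        qed
        show "(1 + \<epsilon>) * real (n choose (n div 2)) \<le> card F" using big by (simp add: C_def)
        show "2 \<le> m" "n \<le> 4 * m" using m4 by linarith+
        show "M < n" by (rule M4)
        have m4': "real n + 8 \<le> 4 * real m" using m4 by linarith
        have M4': "real n + 8 \<le> 4 * real (n - M)" using M4(1) by linarith
        have msr: "real (M - m) = 4 * real s" unfolding ms by simp
        have "\<epsilon> * n \<le> \<epsilon> * (4 * (real m - 1))" using m4' \<epsilon> by (intro mult_left_mono) auto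
        also have "\<dots> = 4 * (\<epsilon> * (real m - 1))" by (rule mult.left_commute)
        finally show "16 * real (M - m) \<le> \<epsilon> * (real m - 1)" using \<epsilon>s unfolding msr by linarith
        have "\<theta> * n < \<theta> * (4 * real m)" using m4' \<theta>0 by (intro mult_strict_left_mono) auto
        also have "\<dots> = 4 * (\<theta> * real m)" by (rule mult.left_commute)
        finally have "\<theta> * n < 4 * (\<theta> * real m)" .
        moreover have "32 * real s \<le> 32 * real k * s" using k by (simp add: mult_le_cancel_right1)
        ultimately have "2 * real (M - m) < \<theta> * m" using \<theta>s unfolding msr by linarith
        then show "2 * real (M - m) < \<epsilon>\<^sup>2 / 512 * m" by (simp only: \<theta>_def)
        have "\<theta> * n < \<theta> * (4 * real (n - M))" using M4' \<theta>0 by (intro mult_strict_left_mono) auto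
        also have "\<dots> = 4 * (\<theta> * real (n - M))" by (rule mult.left_commute)
        finally have "32 * (real k * s) < 4 * (\<theta> * real (n - M))" using \<theta>s by (simp only: mult.assoc)
        then have "2 * real k * real (M - m) < \<theta> * real (n - M)" unfolding msr by (simp add: mult.assoc)
        then show "2 * real k * real (M - m) < \<epsilon>\<^sup>2 / 512 * real (n - M)" by (simp only: \<theta>_def)
        show "inj_on c F" using R(2) by (rule inj_on_subset) (auto simp: F_def)
        show "c ({1..n} - {y}) \<notin> c ` F" if "y \<in> {1..n}" for y
        proof
          assume "c ({1..n} - {y}) \<in> c ` F"
          then obtain S where S: "S \<in> F" "c S = c ({1..n} - {y})" by (metis imageE)
          then have "c S \<in> c ` ?X" using that by (metis imageI)
          then show False using S(1) unfolding F_def Clash_def by blast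
        qed
      qed
      then show False using free by simp
    qed
  qed
qed

theorem theorem1p6:
  fixes k :: nat
  assumes "k \<ge> 3"
  shows "\<exists>\<epsilon> :: nat \<Rightarrow> real. \<epsilon> \<in> o[sequentially](\<lambda>_. 1) \<and>
    (\<forall>n. real (ar_star n (crown_carrier k) (crown_order k))
          = (1 + \<epsilon> n) * real (n choose (n div 2)))"
proof -
  let ?ar = "\<lambda>n. real (ar_star n (crown_carrier k) (crown_order k))"
  let ?C = "\<lambda>n. real (n choose (n div 2))"
  define \<epsilon> where "\<epsilon> n = ?ar n / ?C n - 1" for n
  have C0: "?C n > 0" for n by (simp add: zero_less_binomial_iff)
  have "(\<lambda>n. \<epsilon> n / 1) \<longlonglongrightarrow> 0"
  proof (rule order_tendstoI)
    fix a :: real assume "a < 0"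
    have "0 \<le> \<epsilon> n" for n
      using ar_star_crown_ge[of k n] assms C0[of n] by (simp add: \<epsilon>_def le_divide_eq)
    with \<open>a < 0\<close> show "\<forall>\<^sub>F n in sequentially. a < \<epsilon> n / 1"
      by (intro always_eventually allI) (simp add: less_le_trans)
  next
    fix a :: real assume "0 < a"
    \<comment> \<open>The upper bound needs \<open>e \<le> 1\<close>, and its error
      \<open>3 * e\<close> has to stay below \<open>a\<close>.\<close>
    define e where "e = min 1 (a / 4)"
    have e: "0 < e" "e \<le> 1" "3 * e < a" using \<open>0 < a\<close> by (auto simp: e_def min_def)
    show "\<forall>\<^sub>F n in sequentially. \<epsilon> n / 1 < a"
      using eventually_ar_star_crown_le[OF assms e(1,2)]
    proof eventually_elim
      case (elim n)
      then have "?ar n / ?C n \<le> 1 + 3 * e" using C0[of n] by (simp add: divide_le_eq)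
      then show ?case using e(3) by (simp add: \<epsilon>_def)
    qed
  qed
  then have "\<epsilon> \<in> o[sequentially](\<lambda>_. 1)" by (rule smalloI_tendsto) simp
  moreover have "?ar n = (1 + \<epsilon> n) * ?C n" for n using C0[of n] by (simp add: \<epsilon>_def)
  ultimately show ?thesis by blast
qed

end
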